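(* Let $h>0$, $k_t>k_\ell>0$, $k_f>0$, $\rho>0$ and $\rho_f>0$ be fixed real numbers. For $k\in\mathbb{C}\setminus\{0,k_f,-k_f\}$ set, with the principal square root, $$p=ik\left(1-\frac{k_\ell^2}{k^2}\right)^{1/2},\qquad q=ik\left(1-\frac{k_t^2}{k^2}\right)^{1/2},\qquad d=ik\left(1-\frac{k_f^2}{k^2}\right)^{1/2}.$$ (Symmetric case.) The solutions $k$ of the symmetric fluid dispersion relation $$(q^2-k^2)^2\sin(qh)\cos(ph)+4k^2pq\,\sin(ph)\cos(qh)+i\frac{\rho_f k_t^4}{\rho}\frac{p}{d}\sin(qh)\sin(ph)=0$$ satisfying $\Im(k)\ge0$ can, up to finitely many of them, be enumerated as two sequences $(k_n^{+})_{n\ge n_0}$ and $(k_n^{-})_{n\ge n_0}$ (for some integer $n_0\geq 1$) such that, as $n\to\infty$, $$k_n^{\pm}=\pm\frac{1}{2h}\ln(4\pi n)\mp\frac{1}{8hn}+\frac{i}{2h}\left(\pi\left(2n-\frac12\right)-\frac{\ln(4\pi n)}{2\pi n}-\frac{h^2(k_\ell^2+k_t^2)}{2\pi n}\right)+o\!\left(\frac1n\right).$$ (Antisymmetric case.) The solutions $k$ of the antisymmetric fluid dispersion relation $$(q^2-k^2)^2\sin(ph)\cos(qh)+4k^2pq\,\sin(qh)\cos(ph)-i\frac{\rho_f k_t^4}{\rho}\frac{p}{d}\cos(qh)\cos(ph)=0$$ satisfying $\Im(k)\ge0$ can, up to finitely many of them, be enumerated as two sequences $(k_n^{+})_{n\ge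 n_0}$ and $(k_n^{-})_{n\ge n_0}$ (for some integer $n_0\geq 1$) such that, as $n\to\infty$, $$k_n^{\pm}=\pm\frac{1}{2h}\ln(4\pi n)\mp\frac{3}{8hn}+\frac{i}{2h}\left(\pi\left(2n-\frac32\right)-\frac{\ln(4\pi n)}{2\pi n}-\frac{h^2(k_\ell^2+k_t^2)}{2\pi n}\right)+o\!\left(\frac1n\right).$$
   Context: Physical origin: $k_t=\omega\sqrt{\rho/\mu}$, $k_\ell=\omega\sqrt{\rho/(\lambda+2\mu)}$ and $k_f=\omega/c_f$ are the transverse, longitudinal and fluid wavenumbers at frequency $\omega$, for an isotropic elastic plate of height $2h$, density $\rho$ and Lamé parameters $(\lambda,\mu)$ immersed in an acoustic fluid of density $\rho_f$ and sound speed $c_f$; only the stated inequalities matter here. The principal square root is $z^{1/2}=\sqrt{|z|}\,e^{i\arg(z)/2}$ with $\arg(z)\in(-\pi,\pi]$. Note $p^2=k_\ell^2-k^2$, $q^2=k_t^2-k^2$, $d^2=k_f^2-k^2$. *)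

theory Defs
  imports Complex_Main "HOL-Library.Landau_Symbols"
begin

text \<open>
  \<^term>\<open>csqrt\<close> is the principal square root with argument of the radicand in $(-\pi, \pi]$.
  On the branch cut it gives \<^term>\<open>csqrt (- 1) = \<i>\<close>, which matters for \<^term>\<open>k\<close> real with
  $|k| < \kappa$.
\<close>

definition vertical_wavenumber :: "real \<Rightarrow> complex \<Rightarrow> complex" where
  "vertical_wavenumber \<kappa> k = \<i> * k * csqrt (1 - (of_real \<kappa>)\<^sup>2 / k\<^sup>2)"

definition symmetric_dispersion ::
    "real \<Rightarrow> real \<Rightarrow> real \<Rightarrow> real \<Rightarrow> real \<Rightarrow> real \<Rightarrow> complex \<Rightarrow> complex" where
  "symmetric_dispersion h k\<^sub>t k\<^sub>l k\<^sub>f \<rho> \<rho>\<^sub>f k =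
    (let p = vertical_wavenumber k\<^sub>l k;
         q = vertical_wavenumber k\<^sub>t k;
         d = vertical_wavenumber k\<^sub>f k
     in (q\<^sup>2 - k\<^sup>2)\<^sup>2 * sin (q * of_real h) * cos (p * of_real h)
        + 4 * k\<^sup>2 * p * q * sin (p * of_real h) * cos (q * of_real h)
        + \<i> * of_real (\<rho>\<^sub>f * k\<^sub>t ^ 4 / \<rho>) * (p / d) * sin (q * of_real h) * sin (p * of_real h))"

definition antisymmetric_dispersion ::
    "real \<Rightarrow> real \<Rightarrow> real \<Rightarrow> real \<Rightarrow> real \<Rightarrow> real \<Rightarrow> complex \<Rightarrow> complex" where
  "antisymmetric_dispersion h k\<^sub>t k\<^sub>l k\<^sub>f \<rho> \<rho>\<^sub>f k =
    (let p = vertical_wavenumber k\<^sub>l k;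
         q = vertical_wavenumber k\<^sub>t k;
         d = vertical_wavenumber k\<^sub>f k
     in (q\<^sup>2 - k\<^sup>2)\<^sup>2 * sin (p * of_real h) * cos (q * of_real h)
        + 4 * k\<^sup>2 * p * q * sin (q * of_real h) * cos (p * of_real h)
        - \<i> * of_real (\<rho>\<^sub>f * k\<^sub>t ^ 4 / \<rho>) * (p / d) * cos (q * of_real h) * cos (p * of_real h))"

text \<open>
  The points $0, \pm k_f$ have to be removed explicitly: there \<^term>\<open>k = 0\<close> or \<^term>\<open>d = 0\<close>, and
  the totalised division would assign the dispersion functions a meaningless value.
\<close>

definition upper_solutions :: "real \<Rightarrow> (complex \<Rightarrow> complex) \<Rightarrow> complex set" where
  "upper_solutions k\<^sub>f F =
    {k. k \<notin> {0, of_real k\<^sub>f, - of_real k\<^sub>f} \<and> F k = 0 \<and> Im k \<ge> 0}"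

text \<open>
  Two sequences enumerate all but finitely many elements of \<^term>\<open>S\<close>: all their terms lie in
  \<^term>\<open>S\<close>, no element is listed twice (neither within one sequence nor across the two), and only
  finitely many elements of \<^term>\<open>S\<close> are missed. Terms with index below \<^term>\<open>n\<^sub>0\<close> are irrelevant.
\<close>

definition enumerate_almost_all ::
    "complex set \<Rightarrow> nat \<Rightarrow> (nat \<Rightarrow> complex) \<Rightarrow> (nat \<Rightarrow> complex) \<Rightarrow> bool" where
  "enumerate_almost_all S n\<^sub>0 a b \<longleftrightarrow>
     a ` {n\<^sub>0..} \<subseteq> S \<and> b ` {n\<^sub>0..} \<subseteq> S \<and>
     inj_on a {n\<^sub>0..} \<and> inj_on b {n\<^sub>0..} \<and> a ` {n\<^sub>0..} \<inter> b ` {n\<^sub>0..} = {} \<and>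
     finite (S - (a ` {n\<^sub>0..} \<union> b ` {n\<^sub>0..}))"

end

theory Submission
  imports Defs "HOL-Complex_Analysis.Complex_Analysis" "HOL-Real_Asymp.Real_Asymp"
begin

text \<open>
  Rewriting products of sines and cosines, both dispersion relations become
  $\alpha X - \beta / X + 4 \sigma h k \gamma = 0$ with $X = e^{-i(p+q)h}$, where $\sigma = 1$ in the symmetric and
  $\sigma = -1$ in the antisymmetric case and $\alpha, \beta, \gamma = 1 + o(1/k)$ are holomorphic at infinity. For
  large $k$ this quadratic equation for $X$ says $X^{\tau} = -4 \tau \sigma h k (1 + o(1/k))$ for $\tau = 1$ or $\tau = -1$.
  Since $-i(p+q)h = 2hk - h (k_\ell^2 + k_t^2) / (2k) + o(1/k)$, taking logarithms turns each branch into a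
  fixed-point equation that is a contraction on $\Im k \geq R$. Its fixed points are unique for each branch,
  and iterating the equation gives the asymptotic expansion. Large solutions with $\Im k \geq 0$ lie
  in that half-plane. In a bounded region, multiplying by the conjugate with respect to the sign of
  $d$ removes the square roots, and the zeros of the resulting entire function are finitely many.
\<close>

section \<open>Solutions of the logarithmic equation\<close>

text \<open>Near infinity the radicands tend to 1, so p and q are close to ik and analytic in 1/k.
  In the coefficient of sin((p+q)h) the leading parts 4k^4 and -4k^4 of (q^2-k^2)^2 and 4k^2pq
  cancel, leaving order k^2. In the coefficient of sin((q-p)h) they add up to order k^4, while
  sin((q-p)h) itself is of order 1/k. The ratio of these contributions, of order k, is the origin of
  4hk and hence of ln(4 pi n). The fluid terms are smaller by relative factors of order 1/k^2 and
  1/k^3, so they vanish in o(1/n). The sign \<tau> tells large X from small X, which is the sign of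
  Re k.

  In a bounded region the branch cuts on the real axis obstruct the identity theorem. Sines and
  cosines absorb the roots p and q up to one common factor. Only d stays, and changing the sign of d
  amounts to changing the sign of the fluid coefficient \<open>c\<close>. Hence \<open>c\<close>
  carries no sign condition: the analysis at infinity, applied to \<open>c\<close> and to
  \<open>- c\<close>, yields a real point where the product of the two conjugate functions is
  nonzero.\<close>

lemma analytic_at_lipschitz:
  assumes "f analytic_on {z}"
  obtains r L where "r > 0" "L \<ge> 0"
    "\<And>u v. u \<in> cball z r \<Longrightarrow> v \<in> cball z r \<Longrightarrow> norm (f u - f v) \<le> L * norm (u - v)"
proof -
  obtain s where s: "s > 0" "f holomorphic_on ball z s"
    using assms by (auto simp: analytic_on_def)
  have "cball z (s/2) \<subseteq> ball z s" using s by auto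
  moreover have "deriv f holomorphic_on ball z s"
    using s by (intro holomorphic_deriv) auto
  ultimately have "continuous_on (cball z (s/2)) (deriv f)"
    using holomorphic_on_imp_continuous_on holomorphic_on_subset by blast
  then have "bounded (deriv f ` cball z (s/2))"
    by (intro compact_imp_bounded compact_continuous_image) auto
  then obtain L where L: "\<And>w. w \<in> cball z (s/2) \<Longrightarrow> norm (deriv f w) \<le> L" "L > 0"
    unfolding bounded_pos by (metis image_eqI)
  have "norm (f u - f v) \<le> L * norm (u - v)" if "u \<in> cball z (s/2)" "v \<in> cball z (s/2)" for u v
  proof (rule field_differentiable_bound[OF convex_cball _ L(1) that])
    fix w assume "w \<in> cball z (s/2)"
    then have "w \<in> ball z s" using s by auto
    then show "(f has_field_derivative deriv f w) (at w within cball z (s/2))"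
      using s holomorphic_derivI[OF s(2) open_ball] by blast
  qed
  with s L(2) show thesis by (intro that[of "s/2" L]) auto
qed

text \<open>Sorts n times the error of the expansion into groups that tend to 0 separately: a
  difference of real logarithms, the quadratic remainder of \<open>Ln (1 + z)\<close>, the deviation
  of \<open>z\<close> from its leading term, and the first-order part of \<open>e\<close>. In use,
  \<open>L\<close> is \<open>Ln (1 + z)\<close>, \<open>l\<^sub>2\<close> is
  \<open>ln (2 * \<theta>)\<close> and \<open>l\<^sub>4\<close> is
  \<open>ln (4 * pi * n)\<close>.\<close>

lemma expansion_identity:
  fixes n h \<tau> :: complex
  assumes "n \<noteq> 0" "h \<noteq> 0" "\<tau> = 1 \<or> \<tau> = - 1"
  shows "(\<tau> / (2 * h) * (l\<^sub>2 + L) + \<i> * ((2 * of_real pi * n - a) / (2 * h)) + E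
      - (\<tau> * (l\<^sub>4 / (2 * h) - a / (4 * of_real pi * h * n))
         + \<i> / (2 * h) * (2 * of_real pi * n - a - l\<^sub>4 / (2 * of_real pi * n) - h\<^sup>2 * S / (2 * of_real pi * n)))) * n
    = \<tau> / (2 * h) * (n * (l\<^sub>2 - l\<^sub>4 + a / (2 * of_real pi * n)) + n * (L - z)
         + n * (z + \<i> * \<tau> * (l\<^sub>4 / (2 * of_real pi * n))))
      + (n * E + \<i> * (h * S / (4 * of_real pi)))"
  using assms(3)
proof
  assume [simp]: "\<tau> = 1"
  show ?thesis using assms(1,2) by (simp add: divide_simps) (simp add: algebra_simps power2_eq_square)
next
  assume [simp]: "\<tau> = - 1"
  show ?thesis using assms(1,2) by (simp add: divide_simps) (simp add: algebra_simps power2_eq_square)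
qed

text \<open>Multiplying the fixed-point equation by -2ih turns its branch term into \<theta>; what
  remains is the logarithmic perturbation.\<close>

lemma perturbation_identity:
  fixes h :: complex
  assumes "h \<noteq> 0"
  shows "- 2 * \<i> * h * (\<tau> / (2 * h) * X + \<i> * (\<theta> / (2 * h)) + E) - \<theta> = - \<i> * \<tau> * X - 2 * \<i> * h * E"
proof -
  have "- 2 * \<i> * h * (\<i> * (\<theta> / (2 * h))) = \<theta>" "- 2 * \<i> * h * (\<tau> / (2 * h) * X) = - \<i> * \<tau> * X"
    using assms by simp_all
  then show ?thesis by (simp only: ring_distribs) simp
qed

text \<open>In use, \<open>n / \<theta>\<close> converges, \<open>L\<close> and \<open>E\<close>
  tend to 0, and the first bracket is a difference of real logarithms; so every summand on the left
  tends to 0.\<close>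

lemma remainder_identity:
  fixes n \<theta> :: complex
  assumes "n \<noteq> 0" "\<theta> \<noteq> 0"
  shows "- \<i> * \<tau> * (n / \<theta> * l\<^sub>2 - l\<^sub>4 / (2 * of_real pi)) - n / \<theta> * (\<i> * \<tau> * L + 2 * \<i> * h * E)
    = n * ((- \<i> * \<tau> * (l\<^sub>2 + L) - 2 * \<i> * h * E) / \<theta> + \<i> * \<tau> * (l\<^sub>4 / (2 * of_real pi * n)))"
  using assms by (simp add: field_simps)

text \<open>
  A fixed point of \<open>\<Phi> n\<close> solves, on the $n$-th branch of the logarithm, an equation
  $e^{2 \tau h k} = C k (1 + O(1/k))$ with $|C| = 4h$; the term \<open>e (1 / k)\<close> collects the corrections.
\<close>

locale branch_equation =
  fixes h \<tau> a :: real and S :: real and e :: "complex \<Rightarrow> complex"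
  assumes h_pos: "h > 0" and tau: "\<tau> = 1 \<or> \<tau> = - 1"
    and e_analytic: "e analytic_on {0}" and e_0: "e 0 = 0"
    and e_deriv: "(e has_field_derivative of_real (S / 4)) (at 0)"
begin

definition \<Phi> :: "real \<Rightarrow> complex \<Rightarrow> complex" where
  "\<Phi> x k = of_real (\<tau> / (2 * h)) * (of_real (ln (4 * h)) + Ln (- \<i> * k))
     + \<i> * of_real ((2 * pi * x - a) / (2 * h)) + e (1 / k)"

text \<open>On Im k >= R the logarithm has Lipschitz constant 1/R and \<open>e (1 / k)\<close> has
  one of order 1/R^2, so that of \<open>\<Phi> x\<close> drops to 1/2 for large R. The bound by
  \<open>ln (4 * h * norm k) / (2 * h)\<close> lets the logarithm decide the sign of the real
  part.\<close>

lemma eventually_e_bounds: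
  obtains R\<^sub>1 L where "R\<^sub>1 > 0" "L \<ge> 0"
    "\<And>k. norm k \<ge> R\<^sub>1 \<Longrightarrow> norm (e (1 / k)) \<le> L / norm k"
    "\<And>k. norm k \<ge> R\<^sub>1 \<Longrightarrow> norm (e (1 / k)) \<le> 1"
    "\<And>k. norm k \<ge> R\<^sub>1 \<Longrightarrow> norm (e (1 / k)) < ln (4 * h * norm k) / (2 * h)"
    "\<And>R k l x. R \<ge> R\<^sub>1 \<Longrightarrow> Im k \<ge> R \<Longrightarrow> Im l \<ge> R \<Longrightarrow> norm (\<Phi> x k - \<Phi> x l) \<le> 1/2 * norm (k - l)"
proof -
  obtain r L where rL: "r > 0" "L \<ge> 0"
    "\<And>u v. u \<in> cball 0 r \<Longrightarrow> v \<in> cball 0 r \<Longrightarrow> norm (e u - e v) \<le> L * norm (u - v)"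
    using analytic_at_lipschitz[OF e_analytic] by metis
  have "\<forall>\<^sub>F R in at_top. R > 0 \<and> 1 / R \<le> r \<and> 1 / (2 * h * R) + L / R\<^sup>2 \<le> 1/2 \<and> L / R \<le> 1 \<and>
      L / R < ln (4 * h * R) / (2 * h)"
    using h_pos rL(1,2) by (intro eventually_conj; real_asymp)
  then obtain R\<^sub>1 where R1: "\<And>R. R \<ge> R\<^sub>1 \<Longrightarrow> R > 0 \<and> 1 / R \<le> r \<and> 1 / (2 * h * R) + L / R\<^sup>2 \<le> 1/2 \<and> L / R \<le> 1
      \<and> L / R < ln (4 * h * R) / (2 * h)"
    by (auto simp: eventually_at_top_linorder)
  have in_ball: "1 / k \<in> cball 0 r" if "norm k \<ge> R\<^sub>1" for k :: complex
    using R1[OF that] by (simp add: norm_divide)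
  have A: "norm (e (1 / k)) \<le> L / norm k" if "norm k \<ge> R\<^sub>1" for k
    using rL(3)[OF in_ball[OF that], of 0] rL(1) e_0 by (simp add: norm_divide)
  show thesis
  proof (rule that[of R\<^sub>1 L])
    fix R k l x assume R: "R \<ge> R\<^sub>1" and k: "Im k \<ge> R" and l: "Im l \<ge> R"
    have R0: "R > 0" using R1[OF R] by auto
    have H: "convex {k. Im k \<ge> R}" by (rule convex_halfspace_Im_ge)
    \<comment> \<open>For Im k >= R > 0 the point -ik has positive real part, so the principal
      logarithm is analytic on this convex set.\<close>
    have 1: "norm (Ln (- \<i> * k) - Ln (- \<i> * l)) \<le> 1 / R * norm (k - l)"
    proof (rule field_differentiable_bound[OF H, where f' = "\<lambda>z. 1 / z"])
      fix z assume z: "z \<in> {k. Im k \<ge> R}"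
      then have "- \<i> * z \<notin> \<real>\<^sub>\<le>\<^sub>0" "z \<noteq> 0" using R0 by (auto simp: complex_nonpos_Reals_iff)
      then show "((\<lambda>z. Ln (- \<i> * z)) has_field_derivative 1 / z) (at z within {k. Im k \<ge> R})"
        by (auto intro!: derivative_eq_intros simp: field_simps)
      have "R \<le> norm z" using z abs_Im_le_cmod[of z] by auto
      then show "norm (1 / z) \<le> 1 / R" using R0 by (simp add: norm_divide frac_le)
    qed (use k l in auto)
    have nk: "R \<le> norm k" "R \<le> norm l" using k l abs_Im_le_cmod[of k] abs_Im_le_cmod[of l] by auto
    then have nz: "k \<noteq> 0" "l \<noteq> 0" using R0 by auto
    have "norm (e (1 / k) - e (1 / l)) \<le> L * norm (1 / k - 1 / l)"
      using nk R by (intro rL(3) in_ball) auto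
    also have "1 / k - 1 / l = (l - k) / (k * l)" using nz by (simp add: field_simps)
    also have "norm \<dots> \<le> norm (k - l) / (R * R)"
      unfolding norm_divide norm_mult norm_minus_commute[of l]
      using nk R0 by (intro divide_left_mono mult_mono mult_pos_pos) auto
    finally have 2: "norm (e (1 / k) - e (1 / l)) \<le> L * (norm (k - l) / (R * R))"
      using rL(2) by (simp add: mult_left_mono)
    have "\<Phi> x k - \<Phi> x l = of_real (\<tau> / (2 * h)) * (Ln (- \<i> * k) - Ln (- \<i> * l)) + (e (1 / k) - e (1 / l))"
      by (simp add: \<Phi>_def algebra_simps)
    also have "norm \<dots> \<le> 1 / (2 * h) * (1 / R * norm (k - l)) + L * (norm (k - l) / (R * R))"
      by (intro order.trans[OF norm_triangle_ineq] add_mono 2)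
         (use tau h_pos divide_right_mono[OF 1, of "2 * h"] in \<open>auto simp: norm_mult norm_divide mult_ac\<close>)
    also have "\<dots> = (1 / (2 * h * R) + L / R\<^sup>2) * norm (k - l)"
      by (simp add: algebra_simps power2_eq_square)
    also have "\<dots> \<le> 1/2 * norm (k - l)"
      using R1[OF R] by (intro mult_right_mono) auto
    finally show "norm (\<Phi> x k - \<Phi> x l) \<le> 1/2 * norm (k - l)" .
  next
    show "R\<^sub>1 > 0" "L \<ge> 0" using R1[of R\<^sub>1] rL by auto
    show "norm (e (1 / k)) \<le> 1" if "norm k \<ge> R\<^sub>1" for k
      using A[OF that] R1[OF that] by linarith
    show "norm (e (1 / k)) < ln (4 * h * norm k) / (2 * h)" if "norm k \<ge> R\<^sub>1" for k
      using A[OF that] R1[OF that] by linarith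
  qed (fact A)
qed

text \<open>In the upper half-plane the argument of -ik is below pi/2 in modulus and contributes at
  most pi/(4h); the 1 bounds \<open>e (1 / k)\<close>. Hence the imaginary part of a fixed point
  determines its branch index up to a bounded error.\<close>

lemma Im_\<Phi>:
  assumes "Im k > 0" "norm (e (1 / k)) \<le> 1"
  shows "\<bar>Im (\<Phi> x k) - (2 * pi * x - a) / (2 * h)\<bar> \<le> pi / (4 * h) + 1"
proof -
  have "- \<i> * k \<noteq> 0" using assms by auto
  then have "\<bar>Im (Ln (- \<i> * k))\<bar> < pi / 2"
    by (subst Re_Ln_pos_lt) (use assms(1) in auto)
  then have "\<bar>\<tau> / (2 * h) * Im (Ln (- \<i> * k))\<bar> \<le> pi / (4 * h)"
    using tau h_pos by (auto simp: abs_mult field_simps)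
  moreover have "\<bar>Im (e (1 / k))\<bar> \<le> 1"
    using assms(2) abs_Im_le_cmod[of "e (1/k)"] by linarith
  moreover have "Im (\<Phi> x k) = \<tau> / (2 * h) * Im (Ln (- \<i> * k)) + (2 * pi * x - a) / (2 * h) + Im (e (1 / k))"
    by (simp add: \<Phi>_def)
  ultimately show ?thesis by linarith
qed

text \<open>The logarithm contributes \<open>\<tau>\<close> times a positive quantity that dominates
  \<open>e (1 / k)\<close>. This keeps the two families disjoint: one lies to the right, the other
  to the left of the imaginary axis.\<close>

lemma fixed_point_sign:
  obtains R\<^sub>0 where "R\<^sub>0 > 0" "\<And>k x. Im k \<ge> R\<^sub>0 \<Longrightarrow> k = \<Phi> x k \<Longrightarrow> \<tau> * Re k > 0"
proof -
  obtain R\<^sub>1 where R1: "R\<^sub>1 > 0"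
    "\<And>k. norm k \<ge> R\<^sub>1 \<Longrightarrow> norm (e (1 / k)) < ln (4 * h * norm k) / (2 * h)"
    using eventually_e_bounds by metis
  show thesis
  proof (rule that[OF R1(1)])
    fix k x assume k: "Im k \<ge> R\<^sub>1" "k = \<Phi> x k"
    have nk: "norm k \<ge> R\<^sub>1" using k abs_Im_le_cmod[of k] by auto
    then have k0: "k \<noteq> 0" using R1(1) by auto
    have "Re k = Re (\<Phi> x k)" using k(2) by simp
    also have "\<dots> = \<tau> / (2 * h) * (ln (4 * h) + ln (norm k)) + Re (e (1 / k))"
      using k0 by (simp add: \<Phi>_def norm_mult)
    also have "ln (4 * h) + ln (norm k) = ln (4 * h * norm k)"
      using h_pos k0 by (simp add: ln_mult)
    finally have "Re k = \<tau> / (2 * h) * ln (4 * h * norm k) + Re (e (1 / k))" .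
    moreover have "\<bar>Re (e (1 / k))\<bar> < ln (4 * h * norm k) / (2 * h)"
      using R1(2)[OF nk] abs_Re_le_cmod[of "e (1/k)"] by linarith
    ultimately show "\<tau> * Re k > 0" using tau by (auto simp: algebra_simps)
  qed
qed

definition target :: "nat \<Rightarrow> complex" where
  "target n = of_real \<tau> * of_real (ln (4 * pi * n) / (2 * h) - a / (4 * pi * h * n))
    + \<i> / of_real (2 * h) * of_real (2 * pi * n - a - ln (4 * pi * n) / (2 * pi * n) - h\<^sup>2 * S / (2 * pi * n))"

text \<open>For large x, \<open>\<Phi> x\<close> maps the closed half-plane Im k >= R into itself
  and Banach's theorem applies; for very negative x the image misses the half-plane. Only finitely
  many integers remain in between, each with at most one fixed point. The statement leaves R and
  \<open>n\<^sub>0\<close> free because both families must later share a threshold and a starting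
  index.\<close>

lemma fixed_points:
  obtains R\<^sub>0 where "R\<^sub>0 > 0"
    "\<And>R. R \<ge> R\<^sub>0 \<Longrightarrow> \<exists>N \<kappa>. (\<forall>n\<ge>N. Im (\<kappa> n) \<ge> R \<and> \<kappa> n = \<Phi> (real n) (\<kappa> n)) \<and>
       (\<forall>n\<^sub>0\<ge>N. finite ({k. Im k \<ge> R \<and> (\<exists>m::int. k = \<Phi> (of_int m) k)} - \<kappa> ` {n\<^sub>0..}))"
proof -
  obtain R\<^sub>1 L where R1: "R\<^sub>1 > 0" "L \<ge> 0"
    "\<And>k. norm k \<ge> R\<^sub>1 \<Longrightarrow> norm (e (1 / k)) \<le> L / norm k"
    "\<And>k. norm k \<ge> R\<^sub>1 \<Longrightarrow> norm (e (1 / k)) \<le> 1"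
    "\<And>k. norm k \<ge> R\<^sub>1 \<Longrightarrow> norm (e (1 / k)) < ln (4 * h * norm k) / (2 * h)"
    "\<And>R k l x. R \<ge> R\<^sub>1 \<Longrightarrow> Im k \<ge> R \<Longrightarrow> Im l \<ge> R \<Longrightarrow> norm (\<Phi> x k - \<Phi> x l) \<le> 1/2 * norm (k - l)"
    by (rule eventually_e_bounds, rule that, assumption+)
  show thesis
  proof (rule that[OF R1(1)])
    fix R assume R: "R \<ge> R\<^sub>1"
    define H where "H = {k. Im k \<ge> R}"
    have HI: "\<bar>Im (\<Phi> x k) - (2 * pi * x - a) / (2 * h)\<bar> \<le> pi / (4 * h) + 1" if "k \<in> H" for x k
    proof (rule Im_\<Phi>)
      show "Im k > 0" using that R R1(1) by (auto simp: H_def)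
      show "norm (e (1 / k)) \<le> 1" using that R abs_Im_le_cmod[of k] by (intro R1(4)) (auto simp: H_def)
    qed
    have uniq: "k = l" if "k \<in> H" "l \<in> H" "k = \<Phi> x k" "l = \<Phi> x l" for k l x
    proof -
      have "norm (\<Phi> x k - \<Phi> x l) \<le> 1/2 * norm (k - l)"
        using that(1,2) by (intro R1(6)[OF R]) (auto simp: H_def)
      then show ?thesis unfolding that(3,4)[symmetric] by simp
    qed
    have "\<forall>\<^sub>F x in at_top. (2 * pi * x - a) / (2 * h) - (pi / (4 * h) + 1) \<ge> R"
      using h_pos by real_asymp
    then obtain x\<^sub>0 where x0: "\<And>x. x \<ge> x\<^sub>0 \<Longrightarrow> (2 * pi * x - a) / (2 * h) - (pi / (4 * h) + 1) \<ge> R"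
      by (auto simp: eventually_at_top_linorder)
    have ex: "\<exists>k. k \<in> H \<and> k = \<Phi> x k" if "x \<ge> x\<^sub>0" for x
    proof -
      have "closed H" unfolding H_def by (rule closed_halfspace_Im_ge)
      moreover have "\<Phi> x ` H \<subseteq> H"
      proof
        fix w assume "w \<in> \<Phi> x ` H"
        then obtain k where k: "k \<in> H" "w = \<Phi> x k" by auto
        have "Im (\<Phi> x k) \<ge> R" using HI[OF k(1), of x] x0[OF that] by linarith
        then show "w \<in> H" using k by (simp add: H_def)
      qed
      moreover have "\<i> * of_real R \<in> H" by (simp add: H_def)
      then have "H \<noteq> {}" by blast
      moreover have "\<forall>k\<in>H. \<forall>l\<in>H. dist (\<Phi> x k) (\<Phi> x l) \<le> 1/2 * dist k l"
        by (intro ballI, unfold dist_norm, rule R1(6)[OF R]) (simp_all only: H_def mem_Collect_eq)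
      ultimately have "\<exists>!k\<in>H. \<Phi> x k = k"
        by (intro Banach_fix[of _ "1/2"]) (simp_all add: complete_eq_closed)
      then show ?thesis by metis
    qed
    define N where "N = nat \<lceil>x\<^sub>0\<rceil>"
    have N: "real n \<ge> x\<^sub>0" if "n \<ge> N" for n using that unfolding N_def by linarith
    obtain \<kappa> where \<kappa>: "\<And>n. n \<ge> N \<Longrightarrow> \<kappa> n \<in> H \<and> \<kappa> n = \<Phi> (real n) (\<kappa> n)"
      using ex[OF N] by metis
    have fin: "finite ({k. k \<in> H \<and> (\<exists>m::int. k = \<Phi> (of_int m) k)} - \<kappa> ` {n\<^sub>0..})" if n0: "n\<^sub>0 \<ge> N" for n\<^sub>0
    proof -
      have "\<forall>\<^sub>F x in at_bot. (2 * pi * x - a) / (2 * h) + (pi / (4 * h) + 1) < R"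
        using h_pos by real_asymp
      then obtain y\<^sub>0 where y0: "\<And>x. x \<le> y\<^sub>0 \<Longrightarrow> (2 * pi * x - a) / (2 * h) + (pi / (4 * h) + 1) < R"
        by (auto simp: eventually_at_bot_linorder)
      define F where "F = (\<lambda>m. {k. k \<in> H \<and> k = \<Phi> (of_int m) k})"
      have "{k. k \<in> H \<and> (\<exists>m::int. k = \<Phi> (of_int m) k)} - \<kappa> ` {n\<^sub>0..} \<subseteq> (\<Union>m\<in>{\<lfloor>y\<^sub>0\<rfloor>..int n\<^sub>0}. F m)"
      proof safe
        fix k and m :: int assume k: "k \<in> H" "k = \<Phi> (of_int m) k" "k \<notin> \<kappa> ` {n\<^sub>0..}"
        have "m \<le> int n\<^sub>0"
        proof (rule ccontr)
          assume "\<not> m \<le> int n\<^sub>0"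
          then obtain j where j: "m = int j" "j \<ge> n\<^sub>0" by (cases m) auto
          have "\<kappa> j = k"
          proof (rule uniq)
            show "\<kappa> j \<in> H" "\<kappa> j = \<Phi> (real j) (\<kappa> j)" using \<kappa>[OF order.trans[OF n0 j(2)]] by auto
            show "k \<in> H" "k = \<Phi> (real j) k" using k(1,2) unfolding j(1) of_int_of_nat_eq .
          qed
          then show False using k(3) j(2) by blast
        qed
        moreover have "m \<ge> \<lfloor>y\<^sub>0\<rfloor>"
        proof (rule ccontr)
          assume "\<not> m \<ge> \<lfloor>y\<^sub>0\<rfloor>"
          then have "real_of_int m \<le> y\<^sub>0" by linarith
          from y0[OF this] HI[OF k(1), of "of_int m"] have "Im (\<Phi> (of_int m) k) < R" by linarith
          then show False unfolding k(2)[symmetric] using k(1) by (simp add: H_def)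
        qed
        ultimately show "k \<in> (\<Union>m\<in>{\<lfloor>y\<^sub>0\<rfloor>..int n\<^sub>0}. F m)" using k(1,2) by (intro UN_I[of m]) (simp_all only: F_def mem_Collect_eq atLeastAtMost_iff simp_thms)
      qed
      moreover have "finite (F m)" for m
      proof (cases "F m = {}")
        case False
        then obtain k where k: "k \<in> F m" by auto
        then have "F m \<subseteq> {k}" using uniq unfolding F_def by blast
        then show ?thesis using finite_subset by blast
      qed auto
      ultimately show ?thesis by (meson finite_UN_I finite_atLeastAtMost_int finite_subset)
    qed
    show "\<exists>N \<kappa>. (\<forall>n\<ge>N. Im (\<kappa> n) \<ge> R \<and> \<kappa> n = \<Phi> (real n) (\<kappa> n)) \<and>
       (\<forall>n\<^sub>0\<ge>N. finite ({k. Im k \<ge> R \<and> (\<exists>m::int. k = \<Phi> (of_int m) k)} - \<kappa> ` {n\<^sub>0..}))"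
      using \<kappa> fin by (intro exI[of _ N] exI[of _ \<kappa>] conjI allI impI) (simp_all only: H_def mem_Collect_eq)
  qed
qed

lemma fixed_point_inj: "\<Phi> x k = \<Phi> y k \<Longrightarrow> x = y"
  using h_pos by (auto simp: \<Phi>_def field_simps)

section \<open>Asymptotic expansion of the fixed points\<close>

text \<open>With \<theta> = 2 pi n - a, the equation takes the form -ik = \<theta> (1 + z) / (2h)
  with z = O(ln n / n). Replacing Ln(1 + z) by z costs O((ln n / n)^2), which is o(1/n), so the
  leading term of z already gives everything up to o(1/n).\<close>

lemma fixed_point_asymptotics:
  obtains R\<^sub>0 where "R\<^sub>0 > 0"
    "\<And>\<kappa>. \<forall>\<^sub>F n in sequentially. Im (\<kappa> n) \<ge> R\<^sub>0 \<and> \<kappa> n = \<Phi> (real n) (\<kappa> n) \<Longrightarrow>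
      (\<lambda>n. \<kappa> n - target n) \<in> o(\<lambda>n. 1 / of_nat n)"
proof -
  obtain R\<^sub>1 L where R1: "R\<^sub>1 > 0" "L \<ge> 0"
    "\<And>k. norm k \<ge> R\<^sub>1 \<Longrightarrow> norm (e (1 / k)) \<le> L / norm k"
    "\<And>k. norm k \<ge> R\<^sub>1 \<Longrightarrow> norm (e (1 / k)) \<le> 1"
    "\<And>k. norm k \<ge> R\<^sub>1 \<Longrightarrow> norm (e (1 / k)) < ln (4 * h * norm k) / (2 * h)"
    "\<And>R k l x. R \<ge> R\<^sub>1 \<Longrightarrow> Im k \<ge> R \<Longrightarrow> Im l \<ge> R \<Longrightarrow> norm (\<Phi> x k - \<Phi> x l) \<le> 1/2 * norm (k - l)"
    by (rule eventually_e_bounds, rule that, assumption+)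
  show thesis
  proof (rule that[of "max 1 R\<^sub>1"])
    fix \<kappa> :: "nat \<Rightarrow> complex"
    assume "\<forall>\<^sub>F n in sequentially. Im (\<kappa> n) \<ge> max 1 R\<^sub>1 \<and> \<kappa> n = \<Phi> (real n) (\<kappa> n)"
    then have ev: "\<forall>\<^sub>F n in sequentially. Im (\<kappa> n) \<ge> 1 \<and> norm (\<kappa> n) \<ge> 1 \<and> norm (\<kappa> n) \<ge> R\<^sub>1
        \<and> \<kappa> n = \<Phi> (real n) (\<kappa> n)"
    proof eventually_elim
      case (elim n)
      then show ?case using abs_Im_le_cmod[of "\<kappa> n"] by auto
    qed
    define \<theta> where "\<theta> = (\<lambda>n. 2 * pi * real n - a)"
    have \<theta>_pos: "\<forall>\<^sub>F n in sequentially. \<theta> n > 0" unfolding \<theta>_def by real_asymp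

    have "filterlim (\<lambda>n. Im (\<kappa> n)) at_top sequentially"
    proof (rule filterlim_at_top_mono)
      show "filterlim (\<lambda>n. (2 * pi * real n - a) / (2 * h) - (pi / (4 * h) + 1)) at_top sequentially"
        using h_pos by real_asymp
      show "\<forall>\<^sub>F n in sequentially. (2 * pi * real n - a) / (2 * h) - (pi / (4 * h) + 1) \<le> Im (\<kappa> n)"
        using ev
      proof eventually_elim
        case (elim n)
        then have "Im (\<kappa> n) = Im (\<Phi> n (\<kappa> n))" by simp
        with Im_\<Phi>[of "\<kappa> n" n] R1(4)[of "\<kappa> n"] elim show ?case by linarith
      qed
    qed
    then have norm_top: "filterlim (\<lambda>n. norm (\<kappa> n)) at_top sequentially"
      by (rule filterlim_at_top_mono) (intro always_eventually allI order.trans[OF abs_ge_self abs_Im_le_cmod])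
    then have "filterlim \<kappa> at_infinity sequentially" by (rule filterlim_at_infinity_conv_norm_at_top[THEN iffD2])
    then have inv_0: "filterlim (\<lambda>n. 1 / \<kappa> n) (at 0) sequentially"
      by (simp add: filterlim_inverse_at_iff[symmetric] divide_inverse)
    have e_lim: "((\<lambda>n. e (1 / \<kappa> n)) \<longlonglongrightarrow> 0)"
    proof -
      have "(e \<longlongrightarrow> 0) (at 0)" using DERIV_isCont[OF e_deriv] e_0 by (simp add: isCont_def)
      from filterlim_compose[OF this inv_0] show ?thesis .
    qed

    \<comment> \<open>A crude linear bound on the fixed points suffices: it only has to make their
      logarithms O(ln n). The constants arise from solving the inequality in \<open>upper\<close>
      for the norm.\<close>
    define C\<^sub>1 where "C\<^sub>1 = (\<bar>ln (4 * h)\<bar> + pi + \<bar>ln h\<bar>) / h + 2"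
    define C\<^sub>2 where "C\<^sub>2 = C\<^sub>1 + (2 * pi + \<bar>a\<bar>) / h"
    have C1: "C\<^sub>1 \<ge> 2" using h_pos by (simp add: C\<^sub>1_def)
    then have C2: "C\<^sub>2 > 0" using h_pos by (auto simp: C\<^sub>2_def intro!: add_pos_nonneg)
    have Ln_bound: "norm (of_real (ln (4 * h)) + Ln (- \<i> * k)) \<le> \<bar>ln (4 * h)\<bar> + pi + ln (norm k)"
      if "norm k \<ge> 1" for k
    proof -
      have "norm (Ln (- \<i> * k)) \<le> \<bar>Re (Ln (- \<i> * k))\<bar> + \<bar>Im (Ln (- \<i> * k))\<bar>" by (rule cmod_le)
      also have "Re (Ln (- \<i> * k)) = ln (norm k)" using that by (subst Re_Ln) (auto simp: norm_mult)
      also have "\<bar>Im (Ln (- \<i> * k))\<bar> \<le> pi"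
      proof -
        have "- \<i> * k \<noteq> 0" using that by auto
        then show ?thesis using mpi_less_Im_Ln[of "- \<i> * k"] Im_Ln_le_pi[of "- \<i> * k"] by linarith
      qed
      finally have "norm (Ln (- \<i> * k)) \<le> ln (norm k) + pi" using that by simp
      moreover have "norm (of_real (ln (4 * h)) + Ln (- \<i> * k)) \<le> \<bar>ln (4 * h)\<bar> + norm (Ln (- \<i> * k))"
        using norm_triangle_ineq[of "of_real (ln (4 * h))" "Ln (- \<i> * k)"] by simp
      ultimately show ?thesis by linarith
    qed
    have upper: "\<forall>\<^sub>F n in sequentially. norm (\<kappa> n) \<le> C\<^sub>2 * n"
      using ev eventually_ge_at_top[of 1]
    proof eventually_elim
      case (elim n)
      let ?k = "\<kappa> n"
      have "norm ?k = norm (\<Phi> n ?k)" using elim by simp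
      also have "\<dots> \<le> norm (of_real (\<tau> / (2 * h)) * (of_real (ln (4 * h)) + Ln (- \<i> * ?k)))
         + norm (\<i> * complex_of_real ((2 * pi * n - a) / (2 * h))) + norm (e (1 / ?k))"
        unfolding \<Phi>_def by (intro order.trans[OF norm_triangle_ineq] add_mono order.refl norm_triangle_ineq)
      also have "norm (of_real (\<tau> / (2 * h)) * (of_real (ln (4 * h)) + Ln (- \<i> * ?k)))
          \<le> (\<bar>ln (4 * h)\<bar> + pi + ln (norm ?k)) / (2 * h)"
        using divide_right_mono[OF Ln_bound[of ?k], of "2 * h"] elim tau h_pos by (auto simp: norm_mult norm_divide)
      \<comment> \<open>\<open>ln x \<le> x - 1\<close> at x = h |k|: after division by 2h the
        linear part is |k|/2, which is absorbed on the left.\<close>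
      also have "ln (norm ?k) \<le> h * norm ?k + \<bar>ln h\<bar>"
      proof -
        have k0: "norm ?k > 0" using elim by linarith
        then have "ln (h * norm ?k) \<le> h * norm ?k - 1" using h_pos by (intro ln_le_minus_one mult_pos_pos)
        moreover have "ln (h * norm ?k) = ln h + ln (norm ?k)" using h_pos k0 by (intro ln_mult_pos)
        ultimately show ?thesis by linarith
      qed
      also have "norm (\<i> * complex_of_real ((2 * pi * n - a) / (2 * h))) \<le> (2 * pi * n + \<bar>a\<bar>) / (2 * h)"
      proof -
        have "0 \<le> 2 * pi * real n" by simp
        then have "\<bar>2 * pi * n - a\<bar> \<le> 2 * pi * n + \<bar>a\<bar>" by linarith
        then have "\<bar>2 * pi * n - a\<bar> / (2 * h) \<le> (2 * pi * n + \<bar>a\<bar>) / (2 * h)"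
          using h_pos by (intro divide_right_mono) auto
        then show ?thesis using h_pos unfolding norm_mult norm_of_real by simp
      qed
      also have "norm (e (1 / ?k)) \<le> 1" using elim R1(4) by auto
      finally have "norm ?k \<le> (\<bar>ln (4 * h)\<bar> + pi + (h * norm ?k + \<bar>ln h\<bar>)) / (2 * h) + (2 * pi * n + \<bar>a\<bar>) / (2 * h) + 1"
        using h_pos by (simp add: divide_right_mono)
      also have "\<dots> = norm ?k / 2 + C\<^sub>1 / 2 + (2 * pi * n + \<bar>a\<bar>) / (2 * h)"
        using h_pos by (simp add: C\<^sub>1_def field_simps)
      finally have "norm ?k \<le> C\<^sub>1 + (2 * pi * n + \<bar>a\<bar>) / h"
        using h_pos by (simp add: field_simps)
      also have "\<dots> \<le> C\<^sub>1 * n + (2 * pi * n + \<bar>a\<bar> * n) / h"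
        using elim h_pos C1 mult_left_mono[of 1 "real n" C\<^sub>1] mult_left_mono[of 1 "real n" "\<bar>a\<bar>"]
        by (intro add_mono divide_right_mono) auto
      also have "\<dots> = C\<^sub>2 * n" using h_pos by (simp add: C\<^sub>2_def field_simps)
      finally show ?case .
    qed

    define \<epsilon> where "\<epsilon> = (\<lambda>n. - 2 * \<i> * of_real h * \<kappa> n - of_real (\<theta> n))"
    have \<epsilon>_eq: "\<forall>\<^sub>F n in sequentially. \<epsilon> n = - \<i> * of_real \<tau> * (of_real (ln (4 * h)) + Ln (- \<i> * \<kappa> n)) - 2 * \<i> * of_real h * e (1 / \<kappa> n)"
      using ev
    proof eventually_elim
      case (elim n)
      have "\<epsilon> n = - 2 * \<i> * of_real h * \<Phi> n (\<kappa> n) - of_real (\<theta> n)"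
        using elim unfolding \<epsilon>_def by auto
      also have "\<dots> = - \<i> * of_real \<tau> * (of_real (ln (4 * h)) + Ln (- \<i> * \<kappa> n)) - 2 * \<i> * of_real h * e (1 / \<kappa> n)"
        using perturbation_identity[of "of_real h" "of_real \<tau>" _ "of_real (\<theta> n)"] h_pos
        unfolding \<Phi>_def \<theta>_def by simp
      finally show ?case .
    qed
    define K where "K = \<bar>ln (4 * h)\<bar> + pi + 2 * h"
    have \<epsilon>_bound: "\<forall>\<^sub>F n in sequentially. norm (\<epsilon> n) \<le> K + ln (C\<^sub>2 * n)"
      using ev upper \<epsilon>_eq
    proof eventually_elim
      case (elim n)
      have "norm (\<epsilon> n) \<le> norm (of_real (ln (4 * h)) + Ln (- \<i> * \<kappa> n)) + 2 * h * norm (e (1 / \<kappa> n))"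
        unfolding elim(3) by (rule order.trans[OF norm_triangle_ineq4]) (use tau h_pos in \<open>auto simp: norm_mult\<close>)
      also have "\<dots> \<le> (\<bar>ln (4 * h)\<bar> + pi + ln (norm (\<kappa> n))) + 2 * h * 1"
        using elim h_pos by (intro add_mono mult_left_mono Ln_bound R1(4)) auto
      also have "ln (norm (\<kappa> n)) \<le> ln (C\<^sub>2 * n)" using elim by (subst ln_le_cancel_iff) auto
      finally show ?case by (simp add: K_def)
    qed
    define z where "z = (\<lambda>n. \<epsilon> n / of_real (\<theta> n))"
    have z_bound: "\<forall>\<^sub>F n in sequentially. norm (z n) \<le> (K + ln (C\<^sub>2 * n)) / \<theta> n"
      using \<epsilon>_bound \<theta>_pos by eventually_elim (simp add: z_def norm_divide divide_right_mono)
    have z_0: "z \<longlonglongrightarrow> 0"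
      by (rule Lim_null_comparison[OF z_bound]) (use C2 in \<open>unfold \<theta>_def, real_asymp\<close>)
    have z_half: "\<forall>\<^sub>F n in sequentially. norm (z n) < 1/2"
      using tendstoD[OF z_0, of "1/2"] by simp
    \<comment> \<open>The factor 2 comes from |z| < 1/2 in the denominator of the remainder estimate
      for the logarithm.\<close>
    have "\<forall>\<^sub>F n in sequentially. norm (of_nat n * (Ln (1 + z n) - z n)) \<le> 2 * n * ((K + ln (C\<^sub>2 * n)) / \<theta> n)\<^sup>2"
      using z_bound z_half
    proof eventually_elim
      case (elim n)
      have "norm (Ln (1 + z n) - z n) \<le> (norm (z n))\<^sup>2 / (1 - norm (z n))"
        using elim by (intro Ln_approx_linear) auto
      also have "\<dots> \<le> ((K + ln (C\<^sub>2 * n)) / \<theta> n)\<^sup>2 / (1/2)"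
        using elim by (intro frac_le power_mono) auto
      finally have "real n * norm (Ln (1 + z n) - z n) \<le> real n * (((K + ln (C\<^sub>2 * n)) / \<theta> n)\<^sup>2 / (1/2))"
        by (rule mult_left_mono) simp
      then show ?case by (simp add: norm_mult mult_ac)
    qed
    then have lim2: "(\<lambda>n. of_nat n * (Ln (1 + z n) - z n)) \<longlonglongrightarrow> 0"
      by (rule Lim_null_comparison) (use C2 in \<open>unfold \<theta>_def, real_asymp\<close>)
    have Ln_0: "(\<lambda>n. Ln (1 + z n)) \<longlonglongrightarrow> 0"
      using tendsto_Ln[OF tendsto_add[OF tendsto_const z_0, of 1]] by simp
    have \<kappa>_z: "\<forall>\<^sub>F n in sequentially. - \<i> * \<kappa> n = of_real (\<theta> n / (2 * h)) * (1 + z n)"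
      using \<theta>_pos
    proof eventually_elim
      case (elim n)
      then have "1 + z n = (of_real (\<theta> n) + \<epsilon> n) / of_real (\<theta> n)"
        by (simp add: z_def add_divide_distrib)
      then have "of_real (\<theta> n / (2 * h)) * (1 + z n) = (of_real (\<theta> n) + \<epsilon> n) / (2 * of_real h)"
        using elim by simp
      also have "\<dots> = - \<i> * \<kappa> n" using h_pos by (simp add: \<epsilon>_def)
      finally show ?case by simp
    qed
    \<comment> \<open>The factors 4h and 1/(2h) combine to 2, so the main term is ln(4 pi n -
      2a).\<close>
    have Ln_eq: "\<forall>\<^sub>F n in sequentially. of_real (ln (4 * h)) + Ln (- \<i> * \<kappa> n) = of_real (ln (2 * \<theta> n)) + Ln (1 + z n)"
      using \<theta>_pos \<kappa>_z z_half
    proof eventually_elim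
      case (elim n)
      have "1 + z n \<noteq> 0" using elim(3) by (auto simp: add_eq_0_iff)
      moreover have "\<theta> n / (2 * h) > 0" using elim h_pos by simp
      ultimately have "Ln (- \<i> * \<kappa> n) = of_real (ln (\<theta> n / (2 * h))) + Ln (1 + z n)"
        unfolding elim(2) using Ln_times_of_real Ln_of_real by metis
      moreover have "ln (2 * \<theta> n) = ln (4 * h) + ln (\<theta> n / (2 * h))"
        using elim h_pos by (subst ln_mult_pos[symmetric]) auto
      ultimately show ?case by simp
    qed

    define T1 T2 T3 T4 where T_defs: "T1 = (\<lambda>n. n * (ln (2 * \<theta> n) - ln (4 * pi * n) + a / (2 * pi * n)))"
      "T2 = (\<lambda>n. of_nat n * (Ln (1 + z n) - z n))"
      "T3 = (\<lambda>n. of_nat n * (z n + \<i> * of_real \<tau> * of_real (ln (4 * pi * n) / (2 * pi * n))))"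
      "T4 = (\<lambda>n. of_nat n * e (1 / \<kappa> n) + \<i> * of_real (h * S / (4 * pi)))"
    \<comment> \<open>ln(4 pi n - 2a) is ln(4 pi n) - a/(2 pi n) up to O(1/n^2): the origin of the
      term a/(4 pi h n) in \<open>target\<close>.\<close>
    have T1: "(\<lambda>n. of_real (T1 n) :: complex) \<longlonglongrightarrow> 0"
    proof -
      have "T1 \<longlonglongrightarrow> 0" unfolding T_defs \<theta>_def by real_asymp
      from tendsto_of_real[OF this] show ?thesis by simp
    qed
    have T2: "T2 \<longlonglongrightarrow> 0" using lim2 by (simp add: T_defs)
    have r: "(\<lambda>n. of_real (n / \<theta> n) :: complex) \<longlonglongrightarrow> of_real (1 / (2 * pi))"
    proof (rule tendsto_of_real)
      have "(\<lambda>n. n / \<theta> n) \<longlonglongrightarrow> inverse pi / 2" unfolding \<theta>_def by real_asymp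
      then show "(\<lambda>n. n / \<theta> n) \<longlonglongrightarrow> 1 / (2 * pi)" by (simp add: field_simps)
    qed
    \<comment> \<open>To first order z is -i \<tau> ln(4 pi n)/(2 pi n). The prefactor
      \<open>\<tau> / (2 * h)\<close> makes the sign disappear, so the imaginary correction is the
      same for both families.\<close>
    have T3: "T3 \<longlonglongrightarrow> 0"
    proof -
      define D where "D = (\<lambda>n. n / \<theta> n * ln (2 * \<theta> n) - ln (4 * pi * n) / (2 * pi))"
      have "D \<longlonglongrightarrow> 0" unfolding D_def \<theta>_def by real_asymp
      from tendsto_of_real[OF this] have D: "(\<lambda>n. of_real (D n) :: complex) \<longlonglongrightarrow> 0" by simp
      have "(\<lambda>n. - \<i> * of_real \<tau> * of_real (D n)
          - of_real (n / \<theta> n) * (\<i> * of_real \<tau> * Ln (1 + z n) + 2 * \<i> * of_real h * e (1 / \<kappa> n))) \<longlonglongrightarrow>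
          - \<i> * of_real \<tau> * 0 - of_real (1 / (2 * pi)) * (\<i> * of_real \<tau> * 0 + 2 * \<i> * of_real h * 0)"
        by (intro tendsto_intros D r Ln_0 e_lim)
      then have "(\<lambda>n. - \<i> * of_real \<tau> * of_real (D n)
          - of_real (n / \<theta> n) * (\<i> * of_real \<tau> * Ln (1 + z n) + 2 * \<i> * of_real h * e (1 / \<kappa> n))) \<longlonglongrightarrow> 0"
        by simp
      then show ?thesis
      proof (rule Lim_transform_eventually)
        show "\<forall>\<^sub>F n in sequentially. - \<i> * of_real \<tau> * of_real (D n)
          - of_real (n / \<theta> n) * (\<i> * of_real \<tau> * Ln (1 + z n) + 2 * \<i> * of_real h * e (1 / \<kappa> n)) = T3 n"
          using \<epsilon>_eq Ln_eq \<theta>_pos eventually_gt_at_top[of 0]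
        proof eventually_elim
          case (elim n)
          have "z n = (- \<i> * of_real \<tau> * (of_real (ln (2 * \<theta> n)) + Ln (1 + z n)) - 2 * \<i> * of_real h * e (1 / \<kappa> n)) / of_real (\<theta> n)"
            using elim(1)[unfolded elim(2)] by (simp only: z_def)
          then have "T3 n = of_nat n * ((- \<i> * of_real \<tau> * (of_real (ln (2 * \<theta> n)) + Ln (1 + z n)) - 2 * \<i> * of_real h * e (1 / \<kappa> n)) / of_real (\<theta> n)
              + \<i> * of_real \<tau> * of_real (ln (4 * pi * n) / (2 * pi * n)))"
            unfolding T_defs by (rule arg_cong)
          then show ?case
            unfolding D_def of_real_diff of_real_mult of_real_divide of_real_numeral of_real_of_nat_eq
            using remainder_identity[of "of_nat n" "of_real (\<theta> n)" "of_real \<tau>"] elim(3,4) by simp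
        qed
      qed
    qed
    \<comment> \<open>\<open>e (1 / \<kappa> n)\<close> behaves like S divided by four times the
      fixed point, and n divided by the fixed point tends to -ih/pi; this gives the term with
      \<open>S\<close> in \<open>target\<close>.\<close>
    have T4: "T4 \<longlonglongrightarrow> 0"
    proof -
      have "((\<lambda>u. e u / u) \<longlongrightarrow> of_real (S / 4)) (at 0)"
        using e_deriv e_0 by (simp add: has_field_derivative_iff)
      from filterlim_compose[OF this inv_0]
      have *: "(\<lambda>n. e (1 / \<kappa> n) / (1 / \<kappa> n)) \<longlonglongrightarrow> of_real (S / 4)" .
      have "(\<lambda>n. e (1 / \<kappa> n) / (1 / \<kappa> n) * (of_real (n / \<theta> n) * (- 2 * \<i> * of_real h) / (1 + z n))
           + \<i> * of_real (h * S / (4 * pi))) \<longlonglongrightarrow>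
           of_real (S / 4) * (of_real (1 / (2 * pi)) * (- 2 * \<i> * of_real h) / (1 + 0))
           + \<i> * of_real (h * S / (4 * pi))"
        by (intro tendsto_intros * r z_0) auto
      also have "of_real (S / 4) * (of_real (1 / (2 * pi)) * (- 2 * \<i> * of_real h) / (1 + 0))
           + \<i> * of_real (h * S / (4 * pi)) = (0 :: complex)"
        by (simp add: field_simps)
      finally show ?thesis
      proof (rule Lim_transform_eventually)
        show "\<forall>\<^sub>F n in sequentially. e (1 / \<kappa> n) / (1 / \<kappa> n) * (of_real (n / \<theta> n) * (- 2 * \<i> * of_real h) / (1 + z n))
           + \<i> * of_real (h * S / (4 * pi)) = T4 n"
          using \<kappa>_z \<theta>_pos ev
        proof eventually_elim
          case (elim n)
          then have k0: "\<kappa> n \<noteq> 0" by auto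
          then have z1: "1 + z n \<noteq> 0" using elim(1) by auto
          have "\<kappa> n = \<i> * (of_real (\<theta> n / (2 * h)) * (1 + z n))" unfolding elim(1)[symmetric] by simp
          then have "of_nat n / \<kappa> n = of_nat n / (\<i> * (of_real (\<theta> n / (2 * h)) * (1 + z n)))" by simp
          also have "\<dots> = of_real (n / \<theta> n) * (- 2 * \<i> * of_real h) / (1 + z n)"
            using z1 h_pos elim(2) by (simp add: divide_simps)
          finally have "of_real (n / \<theta> n) * (- 2 * \<i> * of_real h) / (1 + z n) = of_nat n / \<kappa> n" ..
          then show ?case using k0 unfolding T_defs by simp
        qed
      qed
    qed
    have "(\<lambda>n. of_real (\<tau> / (2 * h)) * (of_real (T1 n) + T2 n + T3 n) + T4 n) \<longlonglongrightarrow>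
        of_real (\<tau> / (2 * h)) * (0 + 0 + 0) + 0"
      by (intro tendsto_intros T1 T2 T3 T4)
    then have "(\<lambda>n. (\<kappa> n - target n) / (1 / of_nat n)) \<longlonglongrightarrow> 0"
    proof (simp, elim Lim_transform_eventually)
      show "\<forall>\<^sub>F n in sequentially. of_real \<tau> * (of_real (T1 n) + T2 n + T3 n) / (2 * of_real h) + T4 n
         = (\<kappa> n - target n) * of_nat n"
        using ev Ln_eq eventually_gt_at_top[of 0]
      proof eventually_elim
        case (elim n)
        have "\<kappa> n = \<Phi> n (\<kappa> n)" using elim(1) by blast
        also have "\<dots> = of_real (\<tau> / (2 * h)) * (of_real (ln (2 * \<theta> n)) + Ln (1 + z n))
             + \<i> * of_real ((2 * pi * n - a) / (2 * h)) + e (1 / \<kappa> n)"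
          unfolding \<Phi>_def elim(2) ..
        finally have "(\<kappa> n - target n) * of_nat n = (of_real (\<tau> / (2 * h)) * (of_real (ln (2 * \<theta> n)) + Ln (1 + z n))
             + \<i> * of_real ((2 * pi * n - a) / (2 * h)) + e (1 / \<kappa> n) - target n) * of_nat n"
          by (rule arg_cong[where f = "\<lambda>w. (w - target n) * of_nat n"])
        also have "\<dots> = of_real (\<tau> / (2 * h)) * (of_real (T1 n) + T2 n + T3 n) + T4 n"
          unfolding T_defs target_def of_real_add of_real_diff of_real_mult of_real_divide of_real_numeral of_real_of_nat_eq of_real_power
          by (rule expansion_identity) (use elim(3) h_pos tau in auto)
        finally show ?case by simp
      qed
    qed
    then show "(\<lambda>n. \<kappa> n - target n) \<in> o(\<lambda>n. 1 / of_nat n)"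
      by (intro smalloI_tendsto) (auto intro: eventually_mono[OF eventually_gt_at_top[of 0]])
  qed auto
qed

end

section \<open>Even entire functions and flat functions\<close>

text \<open>The entire function whose value at z^2 is cos z; applied to squared wavenumbers it makes
  the choice of square root irrelevant.\<close>

definition even_cos :: "complex \<Rightarrow> complex" where
  "even_cos w = cos (csqrt w)"

text \<open>Since cos(sqrt w) has derivative -sin(sqrt w) / (2 sqrt w), this is the entire function
  with value sin z / z at z^2. Defining it by a derivative makes it holomorphic at 0 without a
  further removable singularity.\<close>

definition even_sinc :: "complex \<Rightarrow> complex" where
  "even_sinc w = - 2 * deriv even_cos w"

lemma cos_eq_even_cos: "cos z = even_cos (z\<^sup>2)"
proof -
  have "(csqrt (z\<^sup>2))\<^sup>2 = z\<^sup>2" by simp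
  then have "csqrt (z\<^sup>2) = z \<or> csqrt (z\<^sup>2) = - z" by (rule power2_eq_iff[THEN iffD1])
  then show ?thesis by (auto simp: even_cos_def)
qed

text \<open>\<open>csqrt w\<close> and \<open>\<i> * csqrt (- w)\<close> are equal up to sign and
  cos is even. The cuts of the two expressions meet only at 0, where continuity removes the
  singularity.\<close>

lemma holomorphic_even_cos: "even_cos holomorphic_on A"
proof -
  have minus: "even_cos w = cos (\<i> * csqrt (- w))" for w
    by (simp add: cos_eq_even_cos[of "\<i> * csqrt (- w)"] power_mult_distrib)
  have "even_cos holomorphic_on - \<real>\<^sub>\<le>\<^sub>0"
    unfolding even_cos_def by (intro holomorphic_intros) auto
  moreover have "(\<lambda>w. cos (\<i> * csqrt (- w))) holomorphic_on - \<real>\<^sub>\<ge>\<^sub>0"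
    by (intro holomorphic_intros) auto
  then have "even_cos holomorphic_on - \<real>\<^sub>\<ge>\<^sub>0" unfolding minus[symmetric] .
  ultimately have "even_cos holomorphic_on - \<real>\<^sub>\<le>\<^sub>0 \<union> - \<real>\<^sub>\<ge>\<^sub>0"
    by (intro holomorphic_on_Un) auto
  moreover have "UNIV - {0::complex} \<subseteq> - \<real>\<^sub>\<le>\<^sub>0 \<union> - \<real>\<^sub>\<ge>\<^sub>0"
    by (auto simp: complex_nonpos_Reals_iff complex_nonneg_Reals_iff complex_eq_iff)
  ultimately have "even_cos holomorphic_on UNIV - {0}" by (rule holomorphic_on_subset)
  moreover have "(even_cos \<longlongrightarrow> even_cos 0) (at 0)"
  proof -
    have "(csqrt \<longlongrightarrow> 0) (at 0)"
    proof (rule tendsto_norm_zero_cancel)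
      have "((\<lambda>w::complex. sqrt (norm w)) \<longlongrightarrow> sqrt (norm (0::complex))) (at 0)"
        by (rule tendsto_real_sqrt[OF tendsto_norm[OF tendsto_ident_at]])
      then show "((\<lambda>w. norm (csqrt w)) \<longlongrightarrow> 0) (at 0)"
        unfolding norm_csqrt norm_zero real_sqrt_zero .
    qed
    from tendsto_cos[OF this] show ?thesis
      unfolding even_cos_def csqrt_0 .
  qed
  ultimately have "even_cos holomorphic_on UNIV"
    using no_isolated_singularity'[of "{0}" even_cos UNIV] by blast
  then show ?thesis using holomorphic_on_subset by blast
qed

lemma holomorphic_even_sinc: "even_sinc holomorphic_on A"
proof -
  have "even_sinc holomorphic_on UNIV"
    unfolding even_sinc_def by (intro holomorphic_intros holomorphic_even_cos) auto
  then show ?thesis using holomorphic_on_subset by blast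
qed

lemma sin_eq_even_sinc: "sin z = z * even_sinc (z\<^sup>2)"
proof -
  have "(even_cos has_field_derivative deriv even_cos (z\<^sup>2)) (at (z\<^sup>2))"
    using holomorphic_even_cos[of UNIV] by (intro holomorphic_derivI) auto
  then have "(cos has_field_derivative deriv even_cos (z\<^sup>2) * (2 * z)) (at z)"
    unfolding cos_eq_even_cos[abs_def]
    by (rule DERIV_chain2[where g = "\<lambda>z. z\<^sup>2"]) (auto intro!: derivative_eq_intros)
  from DERIV_unique[OF this DERIV_cos] show ?thesis by (simp add: even_sinc_def algebra_simps)
qed

lemma even_cos_0: "even_cos 0 = 1"
  by (simp add: even_cos_def)

text \<open>Obtained by comparing derivatives at 0 in sin z = z
  \<open>even_sinc (z\<^sup>2)\<close>.\<close>

lemma even_sinc_0: "even_sinc 0 = 1"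
proof -
  have sinc: "((\<lambda>z. z * even_sinc (z\<^sup>2)) has_field_derivative even_sinc 0) (at 0)"
  proof -
    have "(even_sinc has_field_derivative deriv even_sinc 0) (at (0\<^sup>2))"
      using holomorphic_even_sinc[of UNIV] holomorphic_derivI[of even_sinc UNIV 0] by auto
    then have "((\<lambda>z. even_sinc (z\<^sup>2)) has_field_derivative deriv even_sinc 0 * 0) (at 0)"
      by (rule DERIV_chain2[where g = "\<lambda>z. z\<^sup>2"]) (auto intro!: derivative_eq_intros)
    then show ?thesis by (auto intro!: derivative_eq_intros)
  qed
  have "(sin has_field_derivative 1) (at (0::complex))"
    using DERIV_sin[of "0::complex"] by simp
  with sinc show ?thesis unfolding sin_eq_even_sinc[abs_def] by (rule DERIV_unique)
qed

text \<open>
  The coefficients of the dispersion equation are flat as functions of $u = 1/k$, so their logarithms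
  are $o(1/k)$ and do not enter the expansion.
\<close>

definition flat :: "(complex \<Rightarrow> complex) \<Rightarrow> complex \<Rightarrow> bool" where
  "flat f y \<longleftrightarrow> f analytic_on {0} \<and> f 0 = y \<and> (f has_field_derivative 0) (at 0)"

lemma flat_const: "flat (\<lambda>u. y) y"
  by (simp add: flat_def)

lemma flat_power: "n \<ge> 2 \<Longrightarrow> flat (\<lambda>u. u ^ n) 0"
  by (auto simp: flat_def intro!: analytic_intros derivative_eq_intros)

lemma flat_add: "flat f y \<Longrightarrow> flat g z \<Longrightarrow> flat (\<lambda>u. f u + g u) (y + z)"
  by (auto simp: flat_def intro!: analytic_intros derivative_eq_intros)

lemma flat_diff: "flat f y \<Longrightarrow> flat g z \<Longrightarrow> flat (\<lambda>u. f u - g u) (y - z)"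
  by (auto simp: flat_def intro!: analytic_intros derivative_eq_intros)

lemma flat_mult: "flat f y \<Longrightarrow> flat g z \<Longrightarrow> flat (\<lambda>u. f u * g u) (y * z)"
  by (auto simp: flat_def intro!: analytic_intros derivative_eq_intros)

lemma flat_divide: "flat f y \<Longrightarrow> flat g z \<Longrightarrow> z \<noteq> 0 \<Longrightarrow> flat (\<lambda>u. f u / g u) (y / z)"
  by (auto simp: flat_def intro!: analytic_intros derivative_eq_intros)

lemma flat_compose:
  assumes "flat f y" "g analytic_on {y}"
  shows "flat (\<lambda>u. g (f u)) (g y)"
proof -
  have "(\<lambda>u. g (f u)) analytic_on {0}"
    using analytic_on_compose_gen[of f "{0}" g "{y}"] assms by (auto simp: flat_def o_def)
  moreover have g: "(g has_field_derivative deriv g y) (at (f 0))"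
  proof -
    have "f 0 = y" using assms(1) by (simp add: flat_def)
    moreover have "g field_differentiable at y"
      by (rule analytic_on_imp_differentiable_at[OF assms(2)]) simp
    ultimately show ?thesis by (simp add: DERIV_deriv_iff_field_differentiable)
  qed
  moreover from g have "((\<lambda>u. g (f u)) has_field_derivative deriv g y * 0) (at 0)"
    by (rule DERIV_chain2) (use assms(1) in \<open>simp add: flat_def\<close>)
  ultimately show ?thesis
    using assms(1) by (simp add: flat_def)
qed

lemma flat_tendsto: "flat f y \<Longrightarrow> (f \<longlongrightarrow> y) (at 0)"
  by (metis DERIV_isCont flat_def isCont_def)

lemmas flat_intros = flat_const flat_power flat_add flat_diff flat_mult flat_divide

text \<open>Multiplied by X, the equation is quadratic with roots -g(1 + s)/\<alpha> and -g(1 -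
  s)/\<alpha>. The second root is expressed through the product -\<beta>/\<alpha> of both, so that
  only 1 + s appears. In use s is near 1, and 1 - s would suffer cancellation.\<close>

lemma quadratic_roots:
  fixes \<alpha> \<beta> g s X :: complex
  assumes "\<alpha> \<noteq> 0" "\<beta> \<noteq> 0" "g \<noteq> 0" "X \<noteq> 0" "1 + s \<noteq> 0" "s\<^sup>2 = 1 + \<alpha> * \<beta> / g\<^sup>2"
  shows "X * \<alpha> - inverse X * \<beta> + 2 * g = 0 \<longleftrightarrow>
    X = - (g * (1 + s) / \<alpha>) \<or> inverse X = g * (1 + s) / \<beta>"
proof -
  have s: "g\<^sup>2 * s\<^sup>2 = g\<^sup>2 + \<alpha> * \<beta>" using assms by (simp add: field_simps)
  have "(\<alpha> * X + g * (1 + s)) * (g * (1 + s) * X - \<beta>)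
      = g * (1 + s) * (\<alpha> * X\<^sup>2 + 2 * g * X - \<beta>) + (g\<^sup>2 * s\<^sup>2 - g\<^sup>2 - \<alpha> * \<beta>) * X"
    by (simp add: algebra_simps power2_eq_square)
  also have "\<dots> = g * (1 + s) * (\<alpha> * X\<^sup>2 + 2 * g * X - \<beta>)" by (simp add: s)
  also have "\<alpha> * X\<^sup>2 + 2 * g * X - \<beta> = X * (X * \<alpha> - inverse X * \<beta> + 2 * g)"
    using assms by (simp add: field_simps power2_eq_square)
  finally have "X * \<alpha> - inverse X * \<beta> + 2 * g = 0 \<longleftrightarrow>
      \<alpha> * X + g * (1 + s) = 0 \<or> g * (1 + s) * X - \<beta> = 0"
    using assms by (metis mult_eq_0_iff)
  also have "\<alpha> * X + g * (1 + s) = 0 \<longleftrightarrow> X = - (g * (1 + s) / \<alpha>)"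
    using assms(1) by (auto simp: field_simps add_eq_0_iff)
  also have "g * (1 + s) * X - \<beta> = 0 \<longleftrightarrow> inverse X = g * (1 + s) / \<beta>"
    using assms(2,4) by (auto simp: field_simps)
  finally show ?thesis .
qed

section \<open>Solutions in a bounded region\<close>

text \<open>Both families in one formula: products of sines and cosines are rewritten with the
  angles (p+q)h and (q-p)h, and \<open>\<sigma>\<close> is the sign by which the two cases
  differ.\<close>

definition plate_dispersion :: "real \<Rightarrow> real \<Rightarrow> real \<Rightarrow> real \<Rightarrow> complex \<Rightarrow> real \<Rightarrow> complex \<Rightarrow> complex" where
  "plate_dispersion h k\<^sub>t k\<^sub>l k\<^sub>f c \<sigma> k =
    (let p = vertical_wavenumber k\<^sub>l k; q = vertical_wavenumber k\<^sub>t k; d = vertical_wavenumber k\<^sub>f k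
     in (((q\<^sup>2 - k\<^sup>2)\<^sup>2 + 4 * k\<^sup>2 * p * q) * sin ((p + q) * of_real h)
        + \<sigma> * ((q\<^sup>2 - k\<^sup>2)\<^sup>2 - 4 * k\<^sup>2 * p * q) * sin ((q - p) * of_real h)
        + \<i> * c * (p / d) * (\<sigma> * cos ((q - p) * of_real h) - cos ((p + q) * of_real h))) / 2)"

lemma symmetric_eq_plate_dispersion:
  "symmetric_dispersion h k\<^sub>t k\<^sub>l k\<^sub>f \<rho> \<rho>\<^sub>f = plate_dispersion h k\<^sub>t k\<^sub>l k\<^sub>f (of_real (\<rho>\<^sub>f * k\<^sub>t ^ 4 / \<rho>)) 1"
proof
  fix k
  define p q d where "p = vertical_wavenumber k\<^sub>l k" "q = vertical_wavenumber k\<^sub>t k" "d = vertical_wavenumber k\<^sub>f k"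
  note pqd = this
  define B where "B = \<i> * of_real (\<rho>\<^sub>f * k\<^sub>t ^ 4 / \<rho>) * (p / d)"
  define C where "C = (q\<^sup>2 - k\<^sup>2)\<^sup>2"
  show "symmetric_dispersion h k\<^sub>t k\<^sub>l k\<^sub>f \<rho> \<rho>\<^sub>f k = plate_dispersion h k\<^sub>t k\<^sub>l k\<^sub>f (of_real (\<rho>\<^sub>f * k\<^sub>t ^ 4 / \<rho>)) 1 k"
    unfolding symmetric_dispersion_def plate_dispersion_def Let_def pqd[symmetric] B_def[symmetric] C_def[symmetric]
      ring_distribs(2) left_diff_distrib[of q p] sin_add sin_diff cos_add cos_diff
    by (simp add: field_simps)
qed

lemma antisymmetric_eq_plate_dispersion:
  "antisymmetric_dispersion h k\<^sub>t k\<^sub>l k\<^sub>f \<rho> \<rho>\<^sub>f = plate_dispersion h k\<^sub>t k\<^sub>l k\<^sub>f (of_real (\<rho>\<^sub>f * k\<^sub>t ^ 4 / \<rho>)) (- 1)"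
proof
  fix k
  define p q d where "p = vertical_wavenumber k\<^sub>l k" "q = vertical_wavenumber k\<^sub>t k" "d = vertical_wavenumber k\<^sub>f k"
  note pqd = this
  define B where "B = \<i> * of_real (\<rho>\<^sub>f * k\<^sub>t ^ 4 / \<rho>) * (p / d)"
  define C where "C = (q\<^sup>2 - k\<^sup>2)\<^sup>2"
  show "antisymmetric_dispersion h k\<^sub>t k\<^sub>l k\<^sub>f \<rho> \<rho>\<^sub>f k = plate_dispersion h k\<^sub>t k\<^sub>l k\<^sub>f (of_real (\<rho>\<^sub>f * k\<^sub>t ^ 4 / \<rho>)) (- 1) k"
    unfolding antisymmetric_dispersion_def plate_dispersion_def Let_def pqd[symmetric] B_def[symmetric] C_def[symmetric]
      ring_distribs(2) left_diff_distrib[of q p] sin_add sin_diff cos_add cos_diff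
    by (simp add: field_simps)
qed

lemma vertical_wavenumber_square: "k \<noteq> 0 \<Longrightarrow> (vertical_wavenumber \<kappa> k)\<^sup>2 = (of_real \<kappa>)\<^sup>2 - k\<^sup>2"
  by (simp add: vertical_wavenumber_def power_mult_distrib field_simps)

text \<open>Cosines are even and sin(ph), sin(qh) are p, q times even functions, so every term
  contains q in the symmetric case and p in the antisymmetric case. After dividing by this factor, p
  and q occur only through their squares and 1/d is the sole remaining root. \<open>a\<close> and
  \<open>b\<close> are chosen before \<open>c\<close>, so they serve \<open>c\<close> and
  \<open>- c\<close> alike.\<close>

lemma plate_dispersion_factor:
  assumes "\<sigma> = 1 \<or> \<sigma> = - 1"
  obtains r a b where "a holomorphic_on UNIV" "b holomorphic_on UNIV"
    "\<And>c k. k \<noteq> 0 \<Longrightarrow> plate_dispersion h k\<^sub>t k\<^sub>l k\<^sub>f c \<sigma> k = vertical_wavenumber r k * (a k + c * b k / vertical_wavenumber k\<^sub>f k)"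
proof -
  define S C where SC: "S = (\<lambda>\<kappa> k. of_real h * even_sinc (((of_real \<kappa>)\<^sup>2 - k\<^sup>2) * (of_real h)\<^sup>2))"
    "C = (\<lambda>\<kappa> k. even_cos (((of_real \<kappa>)\<^sup>2 - k\<^sup>2) * (of_real h)\<^sup>2))"
  have comp: "(\<lambda>k. f (((of_real \<kappa>)\<^sup>2 - k\<^sup>2) * (of_real h)\<^sup>2)) holomorphic_on UNIV"
    if "f holomorphic_on UNIV" for f and \<kappa> :: real
  proof -
    have "(f \<circ> (\<lambda>k. ((of_real \<kappa>)\<^sup>2 - k\<^sup>2) * (of_real h)\<^sup>2)) holomorphic_on UNIV"
      by (rule holomorphic_on_compose_gen[OF _ that]) (auto intro!: holomorphic_intros)
    then show ?thesis by (simp add: o_def)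
  qed
  have hol: "S \<kappa> holomorphic_on UNIV" "C \<kappa> holomorphic_on UNIV" for \<kappa>
    unfolding SC by (intro holomorphic_intros comp holomorphic_even_sinc holomorphic_even_cos)+
  have sc: "sin (vertical_wavenumber \<kappa> k * of_real h) = vertical_wavenumber \<kappa> k * S \<kappa> k"
    "cos (vertical_wavenumber \<kappa> k * of_real h) = C \<kappa> k" if "k \<noteq> 0" for \<kappa> k
    using that by (simp_all add: sin_eq_even_sinc[of "vertical_wavenumber \<kappa> k * of_real h"]
        cos_eq_even_cos[of "vertical_wavenumber \<kappa> k * of_real h"] SC power_mult_distrib vertical_wavenumber_square)
  define M where "M = (\<lambda>k. (((of_real k\<^sub>t)\<^sup>2 - k\<^sup>2) - k\<^sup>2)\<^sup>2 :: complex)"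
  have M: "M holomorphic_on UNIV" unfolding M_def by (intro holomorphic_intros)
  from assms show thesis
  proof
    assume \<sigma>: "\<sigma> = 1"
    define a where "a = (\<lambda>k. M k * S k\<^sub>t k * C k\<^sub>l k + 4 * k\<^sup>2 * ((of_real k\<^sub>l)\<^sup>2 - k\<^sup>2) * S k\<^sub>l k * C k\<^sub>t k)"
    define b where "b = (\<lambda>k. \<i> * ((of_real k\<^sub>l)\<^sup>2 - k\<^sup>2) * S k\<^sub>t k * S k\<^sub>l k)"
    show thesis
    proof (rule that[of a b k\<^sub>t])
      show "a holomorphic_on UNIV" "b holomorphic_on UNIV"
        unfolding a_def b_def by (intro holomorphic_intros hol M)+
      fix c k :: complex assume k: "k \<noteq> 0"
      define p q where pq: "p = vertical_wavenumber k\<^sub>l k" "q = vertical_wavenumber k\<^sub>t k"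
      have sq: "(of_real k\<^sub>l)\<^sup>2 - k\<^sup>2 = p\<^sup>2" "(of_real k\<^sub>t)\<^sup>2 - k\<^sup>2 = q\<^sup>2"
        using k by (simp_all add: pq vertical_wavenumber_square)
      note sc' = sc[OF k, of k\<^sub>l, folded pq] sc[OF k, of k\<^sub>t, folded pq]
      show "plate_dispersion h k\<^sub>t k\<^sub>l k\<^sub>f c \<sigma> k = vertical_wavenumber k\<^sub>t k * (a k + c * b k / vertical_wavenumber k\<^sub>f k)"
        unfolding plate_dispersion_def Let_def a_def b_def M_def pq[symmetric] sq
          ring_distribs(2)[of p q] left_diff_distrib[of q p "of_real h"] sin_add sin_diff cos_add cos_diff sc' \<sigma>
        by (subst divide_eq_eq) (simp add: divide_inverse algebra_simps power2_eq_square)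
    qed
  next
    assume \<sigma>: "\<sigma> = - 1"
    define a where "a = (\<lambda>k. M k * S k\<^sub>l k * C k\<^sub>t k + 4 * k\<^sup>2 * ((of_real k\<^sub>t)\<^sup>2 - k\<^sup>2) * S k\<^sub>t k * C k\<^sub>l k)"
    define b where "b = (\<lambda>k. - \<i> * C k\<^sub>t k * C k\<^sub>l k)"
    show thesis
    proof (rule that[of a b k\<^sub>l])
      show "a holomorphic_on UNIV" "b holomorphic_on UNIV"
        unfolding a_def b_def by (intro holomorphic_intros hol M)+
      fix c k :: complex assume k: "k \<noteq> 0"
      define p q where pq: "p = vertical_wavenumber k\<^sub>l k" "q = vertical_wavenumber k\<^sub>t k"
      have sq: "(of_real k\<^sub>l)\<^sup>2 - k\<^sup>2 = p\<^sup>2" "(of_real k\<^sub>t)\<^sup>2 - k\<^sup>2 = q\<^sup>2"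
        using k by (simp_all add: pq vertical_wavenumber_square)
      note sc' = sc[OF k, of k\<^sub>l, folded pq] sc[OF k, of k\<^sub>t, folded pq]
      show "plate_dispersion h k\<^sub>t k\<^sub>l k\<^sub>f c \<sigma> k = vertical_wavenumber k\<^sub>l k * (a k + c * b k / vertical_wavenumber k\<^sub>f k)"
        unfolding plate_dispersion_def Let_def a_def b_def M_def pq[symmetric] sq
          ring_distribs(2)[of p q] left_diff_distrib[of q p "of_real h"] sin_add sin_diff cos_add cos_diff sc' \<sigma>
        by (subst divide_eq_eq) (simp add: divide_inverse algebra_simps power2_eq_square)
    qed
  qed
qed

text \<open>The product of ad + cb and ad - cb contains d only through d^2 = k_f^2 - k^2 and is
  therefore entire. Apart from the zeros of the common factor, each solution is one of its zeros.
  The point \<open>x\<close> shows that the product is not identically zero, so its zeros in a disc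
  are finitely many.\<close>

lemma finite_bounded_solutions:
  fixes x :: complex
  assumes "\<sigma> = 1 \<or> \<sigma> = - 1" and x: "x \<noteq> 0" "x\<^sup>2 \<noteq> (of_real k\<^sub>f)\<^sup>2"
    and nz: "plate_dispersion h k\<^sub>t k\<^sub>l k\<^sub>f c \<sigma> x \<noteq> 0" "plate_dispersion h k\<^sub>t k\<^sub>l k\<^sub>f (- c) \<sigma> x \<noteq> 0"
  shows "finite {k. norm k \<le> R \<and> k \<notin> {0, of_real k\<^sub>f, - of_real k\<^sub>f} \<and> plate_dispersion h k\<^sub>t k\<^sub>l k\<^sub>f c \<sigma> k = 0}"
proof -
  obtain r a b where ab: "a holomorphic_on UNIV" "b holomorphic_on UNIV"
    "\<And>c k. k \<noteq> 0 \<Longrightarrow> plate_dispersion h k\<^sub>t k\<^sub>l k\<^sub>f c \<sigma> k = vertical_wavenumber r k * (a k + c * b k / vertical_wavenumber k\<^sub>f k)"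
    using plate_dispersion_factor[OF assms(1), of h k\<^sub>t k\<^sub>l k\<^sub>f] by metis
  define G where "G = (\<lambda>k. (a k)\<^sup>2 * ((of_real k\<^sub>f)\<^sup>2 - k\<^sup>2) - (c * b k)\<^sup>2)"
  have G: "G k = (a k * vertical_wavenumber k\<^sub>f k - c * b k) * (a k * vertical_wavenumber k\<^sub>f k + c * b k)"
    if "k \<noteq> 0" for k
    unfolding G_def vertical_wavenumber_square[OF that, symmetric] by (simp add: algebra_simps power2_eq_square)
  have "vertical_wavenumber k\<^sub>f x \<noteq> 0"
    using vertical_wavenumber_square[OF x(1), of k\<^sub>f] x(2) by auto
  moreover have "a x + c * b x / vertical_wavenumber k\<^sub>f x \<noteq> 0" "a x + (- c) * b x / vertical_wavenumber k\<^sub>f x \<noteq> 0"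
    using nz unfolding ab(3)[OF x(1)] by auto
  ultimately have "a x * vertical_wavenumber k\<^sub>f x + c * b x \<noteq> 0" "a x * vertical_wavenumber k\<^sub>f x - c * b x \<noteq> 0"
    by (simp_all add: field_simps)
  then have "G x \<noteq> 0" unfolding G[OF x(1)] by simp
  have "finite {k \<in> cball 0 R. G k = 0}"
  proof (cases "G constant_on UNIV")
    case True
    then have "G k \<noteq> 0" for k using \<open>G x \<noteq> 0\<close> unfolding constant_on_def by (metis UNIV_I)
    then show ?thesis by simp
  next
    case False
    have "G holomorphic_on UNIV"
      unfolding G_def by (intro holomorphic_intros ab)
    then show ?thesis
      by (rule holomorphic_compact_finite_zeros[OF _ open_UNIV connected_UNIV compact_cball subset_UNIV False])
  qed
  moreover have "{k. norm k \<le> R \<and> k \<notin> {0, of_real k\<^sub>f, - of_real k\<^sub>f} \<and> plate_dispersion h k\<^sub>t k\<^sub>l k\<^sub>f c \<sigma> k = 0}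
      \<subseteq> {of_real r, - of_real r} \<union> {k \<in> cball 0 R. G k = 0}"
  proof
    fix k assume "k \<in> {k. norm k \<le> R \<and> k \<notin> {0, of_real k\<^sub>f, - of_real k\<^sub>f} \<and> plate_dispersion h k\<^sub>t k\<^sub>l k\<^sub>f c \<sigma> k = 0}"
    then have k: "norm k \<le> R" "k \<noteq> 0" "k \<noteq> of_real k\<^sub>f" "k \<noteq> - of_real k\<^sub>f"
      "plate_dispersion h k\<^sub>t k\<^sub>l k\<^sub>f c \<sigma> k = 0" by auto
    have d: "vertical_wavenumber k\<^sub>f k \<noteq> 0"
      using vertical_wavenumber_square[OF k(2), of k\<^sub>f] k(3,4) power2_eq_iff[of k "of_real k\<^sub>f"] by auto
    show "k \<in> {of_real r, - of_real r} \<union> {k \<in> cball 0 R. G k = 0}"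
    proof (cases "G k = 0")
      case True
      then show ?thesis using k(1) by simp
    next
      case False
      then have "a k * vertical_wavenumber k\<^sub>f k + c * b k \<noteq> 0" unfolding G[OF k(2)] by auto
      then have "a k + c * b k / vertical_wavenumber k\<^sub>f k \<noteq> 0" using d by (simp add: field_simps)
      then have "vertical_wavenumber r k = 0" using k(5) ab(3)[OF k(2), of c] by simp
      then have "k\<^sup>2 = (of_real r)\<^sup>2" using vertical_wavenumber_square[OF k(2), of r] by simp
      then show ?thesis unfolding power2_eq_iff by blast
    qed
  qed
  ultimately show ?thesis by (meson finite.emptyI finite_Un finite_insert finite_subset)
qed

section \<open>The dispersion equation near infinity\<close>

locale plate =
  fixes h k\<^sub>t k\<^sub>l k\<^sub>f :: real and c :: complex and \<sigma> :: real
  assumes h_pos: "h > 0" and kl_pos: "k\<^sub>l > 0" and kl_less: "k\<^sub>l < k\<^sub>t"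
    and sigma: "\<sigma> = 1 \<or> \<sigma> = - 1"
begin

abbreviation "H \<equiv> complex_of_real h"
abbreviation "L \<equiv> complex_of_real k\<^sub>l"
abbreviation "T \<equiv> complex_of_real k\<^sub>t"
abbreviation "\<Delta> \<equiv> T\<^sup>2 - L\<^sup>2"

abbreviation "dispersion \<equiv> plate_dispersion h k\<^sub>t k\<^sub>l k\<^sub>f c \<sigma>"

definition root :: "real \<Rightarrow> complex \<Rightarrow> complex" where
  "root \<kappa> u = csqrt (1 - (of_real \<kappa>)\<^sup>2 * u\<^sup>2)"

lemma flat_root: "flat (root \<kappa>) 1"
proof -
  have "flat (\<lambda>u. csqrt (1 - (of_real \<kappa>)\<^sup>2 * u\<^sup>2)) (csqrt (1 - (of_real \<kappa>)\<^sup>2 * 0))"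
  proof (rule flat_compose[of _ _ csqrt])
    show "flat (\<lambda>u. 1 - (of_real \<kappa>)\<^sup>2 * u\<^sup>2) (1 - (of_real \<kappa>)\<^sup>2 * 0)" by (intro flat_intros) simp
  qed (auto intro!: analytic_intros)
  then show ?thesis by (simp add: root_def[abs_def])
qed

lemma root_square: "(root \<kappa> u)\<^sup>2 = 1 - (of_real \<kappa>)\<^sup>2 * u\<^sup>2"
  by (simp add: root_def)

lemma vertical_wavenumber_inverse: "vertical_wavenumber \<kappa> (1 / u) = \<i> / u * root \<kappa> u"
  by (simp add: vertical_wavenumber_def root_def power_divide)

text \<open>
  In terms of $u = 1/k$ and the wavenumbers $p, q, d$: \<open>W u\<close> is $-i(p+q)h$, \<open>\<nu> u\<close> is $((q-p)h)^2$ and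
  \<open>P u\<close> is $u^2 ((q^2-k^2)^2 + 4k^2pq)$. The dispersion equation becomes a quadratic equation for
  $e^{W}$ (\<open>dispersion_exp\<close>), whose roots are expressed by \<open>A 1\<close> and \<open>A (- 1)\<close>.
  The removable singularities at $u = 1/k = 0$ are resolved by
  $1 - (1 - \kappa^2 u^2)^{1/2} = \kappa^2 u^2 / (1 + (1 - \kappa^2 u^2)^{1/2})$.
\<close>

definition P :: "complex \<Rightarrow> complex" where
  "P u = T ^ 4 * u\<^sup>2 - 4 * T\<^sup>2 + 4 * L\<^sup>2 / (1 + root k\<^sub>l u) + 4 * root k\<^sub>l u * T\<^sup>2 / (1 + root k\<^sub>t u)"

definition \<alpha> :: "complex \<Rightarrow> complex \<Rightarrow> complex" where
  "\<alpha> \<tau> u = (P u - \<tau> * c * (u\<^sup>2 * root k\<^sub>l u / root k\<^sub>f u)) / (- 2 * \<Delta>)"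

definition \<nu> :: "complex \<Rightarrow> complex" where
  "\<nu> u = - ((\<Delta> * H)\<^sup>2 * u\<^sup>2 / (root k\<^sub>t u + root k\<^sub>l u)\<^sup>2)"

text \<open>The part of the equation coming from sine and cosine of (q-p)h, rescaled and divided by
  its limit so that the value at 0 is 1. The quotient with \<open>\<Delta> * H\<close> stems from
  (q-p)h, whose square is \<open>\<nu> u\<close>.\<close>

definition \<gamma> :: "complex \<Rightarrow> complex" where
  "\<gamma> u = (((T\<^sup>2 * u\<^sup>2 - 2)\<^sup>2 + 4 * root k\<^sub>l u * root k\<^sub>t u) * (\<Delta> * H / (root k\<^sub>t u + root k\<^sub>l u)) * even_sinc (\<nu> u)
     - c * u ^ 3 * (root k\<^sub>l u / root k\<^sub>f u) * even_cos (\<nu> u)) / (4 * H * \<Delta>)"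

text \<open>The normalised square root of the discriminant required by
  \<open>quadratic_roots\<close> for g = 2\<sigma>hk \<open>\<gamma> u\<close>; the sign disappears
  because \<sigma>^2 = 1.\<close>

definition s :: "complex \<Rightarrow> complex" where
  "s u = csqrt (1 + \<alpha> 1 u * \<alpha> (-1) u * u\<^sup>2 / (4 * H\<^sup>2 * (\<gamma> u)\<^sup>2))"

definition A :: "complex \<Rightarrow> complex \<Rightarrow> complex" where
  "A \<tau> u = \<gamma> u * (1 + s u) / (2 * \<alpha> \<tau> u)"

definition W :: "complex \<Rightarrow> complex" where
  "W u = H * (root k\<^sub>l u + root k\<^sub>t u) / u"

text \<open>Chosen so that \<open>W u\<close> equals 2hk - 2hu \<open>r u\<close>. Its value at 0, a
  quarter of the sum of the squared wavenumbers, is the only first-order correction that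
  survives.\<close>

definition r :: "complex \<Rightarrow> complex" where
  "r u = (L\<^sup>2 / (1 + root k\<^sub>l u) + T\<^sup>2 / (1 + root k\<^sub>t u)) / 2"

definition e :: "real \<Rightarrow> complex \<Rightarrow> complex" where
  "e \<tau> u = of_real (\<tau> / (2 * h)) * Ln (A (of_real \<tau>) u) + u * r u"

lemma \<Delta>_nz: "\<Delta> \<noteq> 0"
proof -
  have "k\<^sub>l\<^sup>2 < k\<^sub>t\<^sup>2" using kl_pos kl_less by (intro power_strict_mono) auto
  then have "complex_of_real (k\<^sub>t\<^sup>2 - k\<^sub>l\<^sup>2) \<noteq> 0" by (subst of_real_eq_0_iff) auto
  then show ?thesis by simp
qed

lemma H_nz: "H \<noteq> 0" using h_pos by simp

text \<open>The leading order has already cancelled in \<open>P\<close>; what survives at 0 is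
  nonzero because \<open>k\<^sub>l < k\<^sub>t\<close>.\<close>

lemma flat_P: "flat P (- 2 * \<Delta>)"
proof -
  have "flat P (T ^ 4 * 0 - 4 * T\<^sup>2 + 4 * L\<^sup>2 / (1 + 1) + 4 * 1 * T\<^sup>2 / (1 + 1))"
    unfolding P_def[abs_def] by (intro flat_intros flat_root) auto
  then show ?thesis by (simp add: algebra_simps)
qed

lemma flat_\<alpha>: "flat (\<alpha> \<tau>) 1"
proof -
  have "flat (\<alpha> \<tau>) ((- 2 * \<Delta> - \<tau> * c * (0 * 1 / 1)) / (- 2 * \<Delta>))"
    unfolding \<alpha>_def[abs_def] using \<Delta>_nz by (intro flat_intros flat_root flat_P) auto
  then show ?thesis using \<Delta>_nz by simp
qed

lemma flat_\<nu>: "flat \<nu> 0"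
proof -
  have "flat (\<lambda>u. 0 - (\<Delta> * H)\<^sup>2 * u\<^sup>2 / ((root k\<^sub>t u + root k\<^sub>l u) * (root k\<^sub>t u + root k\<^sub>l u)))
     (0 - (\<Delta> * H)\<^sup>2 * 0 / ((1 + 1) * (1 + 1)))"
    by (intro flat_intros flat_root) auto
  then show ?thesis by (simp add: \<nu>_def[abs_def] power2_eq_square)
qed

lemma flat_\<gamma>: "flat \<gamma> 1"
proof -
  have 1: "flat (\<lambda>u. even_sinc (\<nu> u)) 1" "flat (\<lambda>u. even_cos (\<nu> u)) 1"
    using flat_compose[OF flat_\<nu>, of even_sinc] flat_compose[OF flat_\<nu>, of even_cos]
      holomorphic_even_sinc[of UNIV] holomorphic_even_cos[of UNIV]
    by (auto simp: even_sinc_0 even_cos_0 analytic_on_holomorphic)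
  have "flat (\<lambda>u. (((T\<^sup>2 * u\<^sup>2 - 2) * (T\<^sup>2 * u\<^sup>2 - 2) + 4 * root k\<^sub>l u * root k\<^sub>t u) * (\<Delta> * H / (root k\<^sub>t u + root k\<^sub>l u)) * even_sinc (\<nu> u)
     - c * u ^ 3 * (root k\<^sub>l u / root k\<^sub>f u) * even_cos (\<nu> u)) / (4 * H * \<Delta>))
     ((((T\<^sup>2 * 0 - 2) * (T\<^sup>2 * 0 - 2) + 4 * 1 * 1) * (\<Delta> * H / (1 + 1)) * 1
     - c * 0 * (1 / 1) * 1) / (4 * H * \<Delta>))"
    using \<Delta>_nz H_nz by (intro flat_intros flat_root 1) auto
  then show ?thesis using \<Delta>_nz H_nz by (simp add: \<gamma>_def[abs_def] power2_eq_square)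
qed

lemma flat_s: "flat s 1"
proof -
  have "flat (\<lambda>u. csqrt (1 + \<alpha> 1 u * \<alpha> (-1) u * u\<^sup>2 / (4 * H\<^sup>2 * (\<gamma> u * \<gamma> u))))
     (csqrt (1 + 1 * 1 * 0 / (4 * H\<^sup>2 * (1 * 1))))"
  proof (rule flat_compose[of _ _ csqrt])
    show "flat (\<lambda>u. 1 + \<alpha> 1 u * \<alpha> (-1) u * u\<^sup>2 / (4 * H\<^sup>2 * (\<gamma> u * \<gamma> u)))
       (1 + 1 * 1 * 0 / (4 * H\<^sup>2 * (1 * 1)))"
      using H_nz by (intro flat_intros flat_\<alpha> flat_\<gamma>) auto
  qed (auto intro!: analytic_intros)
  then show ?thesis by (simp add: s_def[abs_def] power2_eq_square)
qed

lemma flat_A: "flat (A \<tau>) 1"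
proof -
  have "flat (A \<tau>) (1 * (1 + 1) / (2 * 1))"
    unfolding A_def[abs_def] by (intro flat_intros flat_\<alpha> flat_\<gamma> flat_s) auto
  then show ?thesis by simp
qed

lemma flat_r: "flat r (of_real ((k\<^sub>l\<^sup>2 + k\<^sub>t\<^sup>2) / 4))"
proof -
  have "flat r ((L\<^sup>2 / (1 + 1) + T\<^sup>2 / (1 + 1)) / 2)"
    unfolding r_def[abs_def] by (intro flat_intros flat_root) auto
  then show ?thesis by (simp add: add_divide_distrib)
qed

lemma flat_Ln_A: "flat (\<lambda>u. Ln (A \<tau> u)) 0"
proof -
  have "Ln analytic_on {1}" by (auto intro!: analytic_intros)
  from flat_compose[OF flat_A this] show ?thesis by simp
qed

text \<open>The logarithm of \<open>A\<close> is flat with value 0, so the derivative of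
  \<open>e \<tau>\<close> at 0 is the value of \<open>r\<close> there, the same for both
  signs.\<close>

lemma branch_equation_e:
  assumes "\<tau> = 1 \<or> \<tau> = - 1"
  shows "branch_equation h \<tau> (k\<^sub>l\<^sup>2 + k\<^sub>t\<^sup>2) (e \<tau>)"
proof
  have L: "flat (\<lambda>u. of_real (\<tau> / (2 * h)) * Ln (A (of_real \<tau>) u)) (of_real (\<tau> / (2 * h)) * 0)"
    by (intro flat_intros flat_Ln_A)
  show "e \<tau> analytic_on {0}" "e \<tau> 0 = 0"
    unfolding e_def[abs_def] using L flat_r by (auto simp: flat_def intro!: analytic_intros)
  have R: "(r has_field_derivative 0) (at 0)" "r 0 = of_real ((k\<^sub>l\<^sup>2 + k\<^sub>t\<^sup>2) / 4)"
    using flat_r unfolding flat_def by blast+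
  from L have "((\<lambda>u. of_real (\<tau> / (2 * h)) * Ln (A (of_real \<tau>) u)) has_field_derivative 0) (at 0)"
    unfolding flat_def by blast
  from DERIV_add[OF this DERIV_mult[OF DERIV_ident R(1)]]
  show "(e \<tau> has_field_derivative of_real ((k\<^sub>l\<^sup>2 + k\<^sub>t\<^sup>2) / 4)) (at 0)"
    unfolding e_def[abs_def] R(2) by simp
qed (use assms h_pos in auto)

lemma eventually_nonzero:
  "\<forall>\<^sub>F u in at 0. u \<noteq> 0 \<and> 1 + root k\<^sub>l u \<noteq> 0 \<and> 1 + root k\<^sub>t u \<noteq> 0 \<and> root k\<^sub>t u + root k\<^sub>l u \<noteq> 0
     \<and> root k\<^sub>f u \<noteq> 0 \<and> \<alpha> 1 u \<noteq> 0 \<and> \<alpha> (-1) u \<noteq> 0 \<and> \<gamma> u \<noteq> 0 \<and> 1 + s u \<noteq> 0 \<and> A 1 u \<noteq> 0 \<and> A (-1) u \<noteq> 0"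
proof -
  have *: "\<forall>\<^sub>F u in at 0. f u \<noteq> 0" if "flat f y" "y \<noteq> 0" for f y
    using tendsto_imp_eventually_ne[OF flat_tendsto] that by blast
  show ?thesis
    by (intro eventually_conj * [OF flat_add[OF flat_const[of 1] flat_root]] * [OF flat_add[OF flat_root flat_root]]
        *[OF flat_add[OF flat_const[of 1] flat_s]] *[OF flat_root] *[OF flat_\<alpha>] *[OF flat_\<gamma>] *[OF flat_A] eventually_neq_at_within) auto
qed

text \<open>Sine and cosine of (p+q)h are combinations of \<open>exp (W u)\<close> and its inverse.
  The fluid cosine enters their coefficients with opposite signs, hence the argument 1 or -1 of
  \<open>\<alpha>\<close>.\<close>

lemma dispersion_exp:
  assumes u: "u \<noteq> 0" "1 + root k\<^sub>l u \<noteq> 0" "1 + root k\<^sub>t u \<noteq> 0" "root k\<^sub>t u + root k\<^sub>l u \<noteq> 0" "root k\<^sub>f u \<noteq> 0"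
  shows "4 / \<i> * dispersion (1 / u) * u\<^sup>2 / (- 2 * \<Delta>)
    = exp (W u) * \<alpha> 1 u - inverse (exp (W u)) * \<alpha> (-1) u + 2 * (2 * \<sigma> * H * \<gamma> u / u)"
proof -
  define l t f where defs: "l = root k\<^sub>l u" "t = root k\<^sub>t u" "f = root k\<^sub>f u"
  have sq: "l\<^sup>2 = 1 - L\<^sup>2 * u\<^sup>2" "t\<^sup>2 = 1 - T\<^sup>2 * u\<^sup>2" by (simp_all add: defs root_square)
  have nz: "1 + l \<noteq> 0" "1 + t \<noteq> 0" "t + l \<noteq> 0" "f \<noteq> 0" using u by (auto simp: defs)
  define X where "X = exp (W u)"
  define pd where "pd = l / f"
  define x where "x = - \<i> * \<Delta> * H * u / (t + l)"
  define Sn Cs where "Sn = even_sinc (\<nu> u)" "Cs = even_cos (\<nu> u)"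
  define P' Q' where "P' = (T\<^sup>2 * u\<^sup>2 - 2)\<^sup>2 - 4 * l * t" "Q' = (T\<^sup>2 * u\<^sup>2 - 2)\<^sup>2 + 4 * l * t"
  have "(\<i> / u * l + \<i> / u * t) * H = \<i> * W u"
    using u by (simp add: W_def defs field_simps)
  then have sc: "sin ((\<i> / u * l + \<i> / u * t) * H) = \<i> * ((X - inverse X) / 2)"
     "cos ((\<i> / u * l + \<i> / u * t) * H) = (X + inverse X) / 2"
    by (simp_all only: sin_i_times cos_i_times X_def)
  \<comment> \<open>The difference of the roots is an explicit multiple of u^2, which makes (q-p)h
    regular and of order u although p and q are of order 1/u.\<close>
  have "(t - l) * (t + l) = - \<Delta> * u\<^sup>2"
    using sq by (simp add: algebra_simps power2_eq_square)
  then have tl: "t - l = - \<Delta> * u\<^sup>2 / (t + l)" using nz by (simp add: field_simps)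
  have "(\<i> / u * t - \<i> / u * l) * H = \<i> / u * (t - l) * H" by (simp add: algebra_simps diff_divide_distrib)
  also have "\<dots> = x"
  proof -
    have "\<i> / u * (- D * u\<^sup>2 / w) * H = - \<i> * D * H * u / w" for D w :: complex
      using u(1) by (simp add: power2_eq_square mult_ac)
    then show ?thesis unfolding tl x_def .
  qed
  finally have x: "(\<i> / u * t - \<i> / u * l) * H = x" .
  have "x\<^sup>2 = \<nu> u" unfolding x_def \<nu>_def defs[symmetric]
    by (simp add: power_divide power_mult_distrib)
  then have sc2: "sin ((\<i> / u * t - \<i> / u * l) * H) = x * Sn" "cos ((\<i> / u * t - \<i> / u * l) * H) = Cs"
    unfolding x sin_eq_even_sinc cos_eq_even_cos Sn_Cs_def by simp_all
  have q2: "((\<i> / u * t)\<^sup>2 - (1 / u)\<^sup>2)\<^sup>2 = (T\<^sup>2 * u\<^sup>2 - 2)\<^sup>2 / u ^ 4"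
  proof -
    have "(\<i> / u * t)\<^sup>2 - (1 / u)\<^sup>2 = (T\<^sup>2 * u\<^sup>2 - 2) / u\<^sup>2"
      using u by (simp add: power_mult_distrib power_divide sq field_simps)
    then show ?thesis by (simp add: power_divide flip: power_mult)
  qed
  have pq: "4 * (1 / u)\<^sup>2 * (\<i> / u * l) * (\<i> / u * t) = - 4 * l * t / u ^ 4"
    using u by (simp add: power_divide field_simps eval_nat_numeral)
  have D: "dispersion (1 / u) = (P' / u ^ 4 * (\<i> * ((X - inverse X) / 2)) + \<sigma> * (Q' / u ^ 4) * (x * Sn)
        + \<i> * c * pd * (\<sigma> * Cs - (X + inverse X) / 2)) / 2"
    unfolding plate_dispersion_def Let_def vertical_wavenumber_inverse defs[symmetric] sc sc2 q2 pq
    using u nz by (simp add: P'_Q'_def pd_def add_divide_distrib diff_divide_distrib)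
  have P: "P' = u\<^sup>2 * P u"
  proof -
    have 1: "L\<^sup>2 * u\<^sup>2 = (1 - l) * (1 + l)" "T\<^sup>2 * u\<^sup>2 = (1 - t) * (1 + t)"
      using sq by (simp_all add: algebra_simps power2_eq_square)
    then have 2: "L\<^sup>2 * u\<^sup>2 / (1 + l) = 1 - l" "T\<^sup>2 * u\<^sup>2 / (1 + t) = 1 - t" using nz by simp_all
    have "u\<^sup>2 * P u = (T\<^sup>2 * u\<^sup>2)\<^sup>2 - 4 * (T\<^sup>2 * u\<^sup>2) + 4 * (L\<^sup>2 * u\<^sup>2 / (1 + l)) + 4 * l * (T\<^sup>2 * u\<^sup>2 / (1 + t))"
      unfolding P_def defs[symmetric] by (simp add: algebra_simps eval_nat_numeral)
    also have "\<dots> = P'" unfolding 2 P'_Q'_def by (simp add: algebra_simps power2_eq_square)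
    finally show ?thesis by simp
  qed
  have G: "4 * H * \<Delta> * \<gamma> u = Q' * (\<Delta> * H / (t + l)) * Sn - c * u ^ 3 * pd * Cs"
    using \<Delta>_nz H_nz by (simp add: \<gamma>_def P'_Q'_def Sn_Cs_def defs pd_def)
  have al: "\<alpha> \<tau> u * (- 2 * \<Delta>) = P u - \<tau> * c * (u\<^sup>2 * pd)" for \<tau>
    using \<Delta>_nz by (simp add: \<alpha>_def defs pd_def)
  have "4 / \<i> * dispersion (1 / u) * u\<^sup>2 =
      (X * (\<alpha> 1 u * (- 2 * \<Delta>)) - inverse X * (\<alpha> (-1) u * (- 2 * \<Delta>)) + \<sigma> * (- (4 * H * \<Delta> * \<gamma> u) * 2 / u))"
    unfolding al G D P x_def using u(1) nz
    by (simp add: divide_simps) (simp add: algebra_simps eval_nat_numeral)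
  also have "\<dots> = (X * \<alpha> 1 u - inverse X * \<alpha> (-1) u + 2 * (2 * \<sigma> * H * \<gamma> u / u)) * (- 2 * \<Delta>)"
    using u(1) by (simp add: field_simps)
  finally show ?thesis using \<Delta>_nz unfolding X_def by simp
qed

text \<open>One root of the quadratic has size of order |k|, the other of order 1/|k|. Inverting the
  small one gives both conditions the same shape, with \<tau> = 1 for the large and \<tau> = -1 for
  the small root.\<close>

lemma dispersion_zero_iff:
  "\<forall>\<^sub>F u in at 0. dispersion (1 / u) = 0 \<longleftrightarrow>
     (\<exists>\<tau>\<in>{1, -1}. exp (of_real \<tau> * W u) = - 4 * of_real \<tau> * \<sigma> * H / u * A (of_real \<tau>) u)"
  using eventually_nonzero
proof eventually_elim
  case (elim u)
  define g where "g = 2 * \<sigma> * H * \<gamma> u / u"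
  have \<sigma>2: "complex_of_real \<sigma> * \<sigma> = 1" "complex_of_real \<sigma> \<noteq> 0" using sigma by auto
  have g: "g \<noteq> 0" using elim H_nz \<sigma>2 by (simp add: g_def)
  have g2: "g\<^sup>2 = 4 * H\<^sup>2 * (\<gamma> u)\<^sup>2 / u\<^sup>2"
    using \<sigma>2 by (simp add: g_def power_mult_distrib power_divide power2_eq_square)
  have "dispersion (1 / u) = 0 \<longleftrightarrow> 4 / \<i> * dispersion (1 / u) * u\<^sup>2 / (- 2 * \<Delta>) = 0"
    using elim \<Delta>_nz by simp
  also have "\<dots> \<longleftrightarrow> exp (W u) * \<alpha> 1 u - inverse (exp (W u)) * \<alpha> (-1) u + 2 * g = 0"
    unfolding g_def using elim by (subst dispersion_exp) auto
  also have "\<dots> \<longleftrightarrow> exp (W u) = - (g * (1 + s u) / \<alpha> 1 u) \<or> inverse (exp (W u)) = g * (1 + s u) / \<alpha> (-1) u"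
    by (rule quadratic_roots) (use elim g in \<open>auto simp: s_def g2\<close>)
  also have "- (g * (1 + s u) / \<alpha> 1 u) = - 4 * \<sigma> * H / u * A 1 u"
    using elim by (simp add: g_def A_def)
  also have "g * (1 + s u) / \<alpha> (-1) u = 4 * \<sigma> * H / u * A (-1) u"
    using elim by (simp add: g_def A_def)
  finally show ?case by (simp add: exp_minus)
qed

end

section \<open>From exponential conditions to fixed-point equations\<close>

lemma fixed_point_identity:
  fixes H \<tau> :: complex
  assumes "H \<noteq> 0" "\<tau> = 1 \<or> \<tau> = - 1"
  shows "\<tau> * (2 * H * k - 2 * H * E) - (X - \<i> * \<tau> * a + Y + 2 * n * of_real pi * \<i>)
    = 2 * H * \<tau> * (k - (\<tau> / (2 * H) * X + \<i> * ((2 * of_real pi * (\<tau> * n) - a) / (2 * H)) + (\<tau> / (2 * H) * Y + E)))"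
proof -
  have 1: "2 * H * \<tau> * (\<tau> / (2 * H) * x) = \<tau> * (\<tau> * x)" "2 * H * \<tau> * (\<i> * (x / (2 * H))) = \<tau> * (\<i> * x)" for x
    using assms(1) by simp_all
  have "2 * H * \<tau> * (k - (\<tau> / (2 * H) * X + \<i> * ((2 * of_real pi * (\<tau> * n) - a) / (2 * H)) + (\<tau> / (2 * H) * Y + E)))
      = 2 * H * \<tau> * k - (\<tau> * (\<tau> * X) + \<tau> * (\<i> * (2 * of_real pi * (\<tau> * n) - a)) + (\<tau> * (\<tau> * Y) + 2 * H * \<tau> * E))"
    by (simp only: right_diff_distrib distrib_left 1)
  also have "\<dots> = \<tau> * (2 * H * k - 2 * H * E) - (X - \<i> * \<tau> * a + Y + 2 * n * of_real pi * \<i>)"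
    using assms(2) by (auto simp: algebra_simps)
  finally show ?thesis ..
qed

lemma ex_int_sign_iff:
  assumes "\<tau> = 1 \<or> \<tau> = - (1 :: real)"
  shows "(\<exists>n::int. Q (\<tau> * of_int n)) \<longleftrightarrow> (\<exists>m::int. Q (of_int m))"
proof -
  have "(\<exists>n::int. Q (- of_int n)) \<longleftrightarrow> (\<exists>m::int. Q (of_int m))"
    by (metis minus_minus of_int_minus)
  then show ?thesis using assms by auto
qed

text \<open>The phase \<open>a\<close> absorbs the sign \<open>\<sigma>\<close> together with the
  quarter turn introduced by using Ln(-ik) instead of Ln k; its values will be pi/2 and 3
  pi/2.\<close>

locale plate_phase = plate +
  fixes a :: real
  assumes phase: "exp (\<i> * of_real a) = \<i> * of_real \<sigma>"
begin

abbreviation "\<Psi> \<tau> \<equiv> branch_equation.\<Phi> h \<tau> a (e \<tau>)"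

abbreviation "branch_condition \<tau> u \<equiv>
  exp (of_real \<tau> * W u) = - 4 * of_real \<tau> * \<sigma> * H / u * A (of_real \<tau>) u"

lemma exp_phase: "\<tau> = 1 \<or> \<tau> = - 1 \<Longrightarrow> exp (- \<i> * of_real \<tau> * of_real a) = - \<i> * of_real \<tau> * of_real \<sigma>"
  using sigma by (auto simp: exp_minus phase)

lemma W_eq:
  assumes u: "u \<noteq> 0" "1 + root k\<^sub>l u \<noteq> 0" "1 + root k\<^sub>t u \<noteq> 0"
  shows "W u = 2 * H / u - 2 * H * u * r u"
proof -
  have 1: "L\<^sup>2 * u\<^sup>2 = (1 - root k\<^sub>l u) * (1 + root k\<^sub>l u)" "T\<^sup>2 * u\<^sup>2 = (1 - root k\<^sub>t u) * (1 + root k\<^sub>t u)"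
    using root_square[of k\<^sub>l u] root_square[of k\<^sub>t u] by (simp_all add: algebra_simps power2_eq_square)
  then have 2: "L\<^sup>2 * u\<^sup>2 / (1 + root k\<^sub>l u) = 1 - root k\<^sub>l u" "T\<^sup>2 * u\<^sup>2 / (1 + root k\<^sub>t u) = 1 - root k\<^sub>t u"
    using u by simp_all
  have "2 * H * u\<^sup>2 * r u = H * (L\<^sup>2 * u\<^sup>2 / (1 + root k\<^sub>l u) + T\<^sup>2 * u\<^sup>2 / (1 + root k\<^sub>t u))"
    unfolding r_def by (simp add: algebra_simps)
  also have "\<dots> = 2 * H - H * (root k\<^sub>l u + root k\<^sub>t u)" unfolding 2 by (simp add: algebra_simps)
  finally have "H * (root k\<^sub>l u + root k\<^sub>t u) = 2 * H - 2 * H * u\<^sup>2 * r u" by simp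
  then have "W u = (2 * H - 2 * H * u\<^sup>2 * r u) / u" by (simp only: W_def)
  then show ?thesis using u(1) by (simp add: diff_divide_distrib power2_eq_square)
qed

text \<open>The right-hand side of the condition is itself an exponential, so the exponents agree up
  to 2 pi i n. Solving for k multiplies by \<tau> and replaces n by \<tau> n, which still runs
  through all integers.\<close>

lemma branch_condition_iff_fixed_point:
  assumes \<tau>: "\<tau> = 1 \<or> \<tau> = - 1" and u: "u \<noteq> 0" "1 + root k\<^sub>l u \<noteq> 0" "1 + root k\<^sub>t u \<noteq> 0" "A (of_real \<tau>) u \<noteq> 0"
  shows "branch_condition \<tau> u \<longleftrightarrow> (\<exists>m::int. 1 / u = \<Psi> \<tau> (of_int m) (1 / u))"
proof -
  interpret B: branch_equation h \<tau> a "k\<^sub>l\<^sup>2 + k\<^sub>t\<^sup>2" "e \<tau>" by (rule branch_equation_e[OF \<tau>])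
  \<comment> \<open>Ln(-ik) has its cut on the lower imaginary axis, away from the solutions of
    interest. The factor -i is compensated by \<open>exp_phase\<close>: (-i)(-i \<tau> \<sigma>) =
    -\<tau> \<sigma>.\<close>
  define Z where "Z = of_real (ln (4 * h)) + Ln (- \<i> * (1 / u)) - \<i> * of_real \<tau> * of_real a + Ln (A (of_real \<tau>) u)"
  have \<tau>2: "complex_of_real \<tau> * (complex_of_real \<tau> * w) = w" for w using \<tau> by auto
  have "exp Z = exp (of_real (ln (4 * h))) * exp (Ln (- \<i> * (1 / u))) * exp (- \<i> * of_real \<tau> * of_real a) * exp (Ln (A (of_real \<tau>) u))"
    unfolding Z_def by (simp add: exp_add[symmetric])
  also have "exp (of_real (ln (4 * h))) = 4 * H"
    using h_pos exp_ln[of "4 * h"] unfolding exp_of_real by simp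
  also have "exp (Ln (- \<i> * (1 / u))) = - \<i> * (1 / u)" using u by (intro exp_Ln) auto
  also have "exp (Ln (A (of_real \<tau>) u)) = A (of_real \<tau>) u" using u by simp
  also note exp_phase[OF \<tau>]
  finally have Z: "exp Z = - 4 * of_real \<tau> * \<sigma> * H / u * A (of_real \<tau>) u"
    by (simp add: algebra_simps)
  note W = W_eq[OF u(1-3)]
  have key: "of_real \<tau> * W u - (Z + (of_int (2 * n) * pi) * \<i>) = 2 * H * of_real \<tau> * (1 / u - \<Psi> \<tau> (\<tau> * of_int n) (1 / u))" for n
  proof -
    have "of_real \<tau> * W u - (Z + (of_int (2 * n) * pi) * \<i>)
      = of_real \<tau> * (2 * H * (1 / u) - 2 * H * (u * r u)) - (of_real (ln (4 * h)) + Ln (- \<i> * (1 / u))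
          - \<i> * of_real \<tau> * of_real a + Ln (A (of_real \<tau>) u) + 2 * of_int n * of_real pi * \<i>)"
      unfolding W Z_def by simp
    also have "\<dots> = 2 * H * of_real \<tau> * (1 / u - (of_real \<tau> / (2 * H) * (of_real (ln (4 * h)) + Ln (- \<i> * (1 / u)))
        + \<i> * ((2 * of_real pi * (of_real \<tau> * of_int n) - of_real a) / (2 * H)) + (of_real \<tau> / (2 * H) * Ln (A (of_real \<tau>) u) + u * r u)))"
      by (rule fixed_point_identity) (use H_nz \<tau> in auto)
    also have "\<dots> = 2 * H * of_real \<tau> * (1 / u - \<Psi> \<tau> (\<tau> * of_int n) (1 / u))"
      unfolding B.\<Phi>_def e_def by simp
    finally show ?thesis .
  qed
  have "branch_condition \<tau> u \<longleftrightarrow> exp (of_real \<tau> * W u) = exp Z" unfolding Z ..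
  also have "\<dots> \<longleftrightarrow> (\<exists>n::int. of_real \<tau> * W u - (Z + (of_int (2 * n) * pi) * \<i>) = 0)"
    unfolding exp_eq right_minus_eq ..
  also have "\<dots> \<longleftrightarrow> (\<exists>n::int. 1 / u = \<Psi> \<tau> (\<tau> * of_int n) (1 / u))"
  proof -
    have "2 * H * of_real \<tau> * (x - y) = 0 \<longleftrightarrow> x = y" for x y using H_nz \<tau> by auto
    then show ?thesis unfolding key by (simp only:)
  qed
  also have "\<dots> \<longleftrightarrow> (\<exists>m::int. 1 / u = \<Psi> \<tau> (of_int m) (1 / u))"
    by (rule ex_int_sign_iff[OF \<tau>])
  finally show ?thesis .
qed

text \<open>Taking moduli, \<tau> Re W is the logarithm of a number between 2h|k| and 8h|k|. Since
  Re W is 2h Re k up to a bounded term, Re k grows at most logarithmically in |k|.\<close>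

lemma branch_condition_localization:
  assumes \<tau>: "\<tau> = 1 \<or> \<tau> = - 1"
  shows "\<forall>\<^sub>F u in at 0. branch_condition \<tau> u \<longrightarrow> \<bar>Re (1 / u)\<bar> \<le> norm (1 / u) / 2"
proof -
  have "((\<lambda>u. u * r u) \<longlongrightarrow> 0 * of_real ((k\<^sub>l\<^sup>2 + k\<^sub>t\<^sup>2) / 4)) (at 0)"
    by (intro tendsto_mult tendsto_ident_at flat_tendsto[OF flat_r])
  from tendsto_norm[OF this] have "((\<lambda>u. norm (u * r u)) \<longlongrightarrow> 0) (at 0)" by simp
  then have r: "\<forall>\<^sub>F u in at 0. norm (u * r u) < 1" by (rule order_tendstoD) simp
  have "((\<lambda>u. norm (A (of_real \<tau>) u)) \<longlongrightarrow> norm (1 :: complex)) (at 0)"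
    by (intro tendsto_norm flat_tendsto[OF flat_A])
  then have A: "\<forall>\<^sub>F u in at 0. norm (A (of_real \<tau>) u) < 2" "\<forall>\<^sub>F u in at 0. 1/2 < norm (A (of_real \<tau>) u)"
    by (rule order_tendstoD; simp)+
  have "\<forall>\<^sub>F x in at_top. ln (8 * h * x) + 2 * h \<le> h * x \<and> 2 * h * x \<ge> 1" using h_pos by (intro eventually_conj; real_asymp)
  moreover have "filterlim (\<lambda>u::complex. norm (1 / u)) at_top (at 0)"
    using filterlim_at_infinity_imp_norm_at_top[OF filterlim_inverse_at_infinity] by (simp add: divide_inverse)
  ultimately have ev: "\<forall>\<^sub>F u::complex in at 0. ln (8 * h * norm (1 / u)) + 2 * h \<le> h * norm (1 / u) \<and> 2 * h * norm (1 / u) \<ge> 1"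
    unfolding filterlim_iff by blast
  show ?thesis
    using r A ev eventually_nonzero
  proof eventually_elim
    case (elim u)
    show ?case
    proof
      assume E: "branch_condition \<tau> u"
      have u: "u \<noteq> 0" "1 + root k\<^sub>l u \<noteq> 0" "1 + root k\<^sub>t u \<noteq> 0" "A (of_real \<tau>) u \<noteq> 0"
        using elim \<tau> by auto
      let ?x = "4 * h * norm (1 / u) * norm (A (of_real \<tau>) u)"
      have "exp (\<tau> * Re (W u)) = norm (exp (of_real \<tau> * W u))" by simp
      also have "\<dots> = ?x" unfolding E using \<tau> sigma h_pos by (auto simp: norm_mult norm_divide)
      finally have exp: "exp (\<tau> * Re (W u)) = ?x" .
      have "0 < 4 * h * norm (1 / u)" using u(1) h_pos by simp
      then have x: "?x \<le> 8 * h * norm (1 / u)" "?x \<ge> 2 * h * norm (1 / u)"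
        using mult_left_mono[of "norm (A (of_real \<tau>) u)" 2 "4 * h * norm (1 / u)"]
          mult_left_mono[of "1/2" "norm (A (of_real \<tau>) u)" "4 * h * norm (1 / u)"] elim by auto
      then have "?x \<ge> 1" using elim by linarith
      then have "0 \<le> ln ?x" by (rule ln_ge_zero)
      moreover have "\<tau> * Re (W u) = ln ?x" unfolding exp[symmetric] by simp
      moreover have "ln ?x \<le> ln (8 * h * norm (1 / u))"
        using x(1) \<open>?x \<ge> 1\<close> by (subst ln_le_cancel_iff) linarith+
      ultimately have Re_W: "\<bar>Re (W u)\<bar> \<le> ln (8 * h * norm (1 / u))" using \<tau> by auto
      have "W u = 2 * H / u - 2 * H * u * r u" by (rule W_eq[OF u(1-3)])
      then have "2 * H * (1 / u) = W u + 2 * H * (u * r u)" by simp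
      then have "Re (2 * H * (1 / u)) = Re (W u + 2 * H * (u * r u))" by (rule arg_cong)
      moreover have "Re (2 * H * x) = 2 * h * Re x" for x by simp
      ultimately have "2 * h * Re (1 / u) = Re (W u) + 2 * h * Re (u * r u)"
        by (simp only: plus_complex.sel)
      moreover have "\<bar>2 * h * Re (u * r u)\<bar> \<le> 2 * h * 1"
        unfolding abs_mult using h_pos abs_Re_le_cmod[of "u * r u"] elim by (intro mult_mono) auto
      ultimately have "\<bar>2 * h * Re (1 / u)\<bar> \<le> h * norm (1 / u)" using Re_W elim by linarith
      then have "h * (2 * \<bar>Re (1 / u)\<bar>) \<le> h * norm (1 / u)" using h_pos by (simp add: abs_mult)
      then show "\<bar>Re (1 / u)\<bar> \<le> norm (1 / u) / 2" using h_pos by simp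
    qed
  qed
qed

section \<open>Location and enumeration of the solutions\<close>

text \<open>From |Re k| <= |k|/2 and |k| <= |Re k| + |Im k| a large solution with Im k >= 0
  satisfies Im k >= |k|/2. It thus lies where the contraction argument applies, and no large real
  number is a solution.\<close>

lemma large_solutions:
  obtains R where "R > 0"
    "\<And>k. norm k \<ge> R \<Longrightarrow> Im k \<ge> 0 \<Longrightarrow> dispersion k = 0 \<Longrightarrow> Im k \<ge> norm k / 2"
    "\<And>k. norm k \<ge> R \<Longrightarrow> dispersion k = 0 \<longleftrightarrow> (\<exists>m::int. k = \<Psi> 1 (of_int m) k) \<or> (\<exists>m::int. k = \<Psi> (-1) (of_int m) k)"
proof -
  have "\<forall>\<^sub>F u in at 0. (dispersion (1 / u) = 0 \<longrightarrow> \<bar>Re (1 / u)\<bar> \<le> norm (1 / u) / 2) \<and>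
     (dispersion (1 / u) = 0 \<longleftrightarrow> (\<exists>m::int. 1 / u = \<Psi> 1 (of_int m) (1 / u)) \<or> (\<exists>m::int. 1 / u = \<Psi> (-1) (of_int m) (1 / u)))"
    using eventually_nonzero dispersion_zero_iff
      branch_condition_localization[OF disjI1[OF refl]] branch_condition_localization[OF disjI2[OF refl]]
  proof eventually_elim
    case (elim u)
    have D: "dispersion (1 / u) = 0 \<longleftrightarrow> branch_condition 1 u \<or> branch_condition (-1) u"
      unfolding elim(2) by simp
    have "branch_condition 1 u \<longleftrightarrow> (\<exists>m::int. 1 / u = \<Psi> 1 (of_int m) (1 / u))"
      by (rule branch_condition_iff_fixed_point) (use elim(1) in auto)
    moreover have "branch_condition (-1) u \<longleftrightarrow> (\<exists>m::int. 1 / u = \<Psi> (-1) (of_int m) (1 / u))"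
      by (rule branch_condition_iff_fixed_point) (use elim(1) in auto)
    ultimately show ?case using D elim(3,4) by blast
  qed
  then obtain \<delta> where \<delta>: "\<delta> > 0" "\<And>u. u \<noteq> 0 \<Longrightarrow> norm u < \<delta> \<Longrightarrow> (dispersion (1 / u) = 0 \<longrightarrow> \<bar>Re (1 / u)\<bar> \<le> norm (1 / u) / 2) \<and>
     (dispersion (1 / u) = 0 \<longleftrightarrow> (\<exists>m::int. 1 / u = \<Psi> 1 (of_int m) (1 / u)) \<or> (\<exists>m::int. 1 / u = \<Psi> (-1) (of_int m) (1 / u)))"
    unfolding eventually_at by (auto simp: dist_norm)
  have *: "(dispersion k = 0 \<longrightarrow> \<bar>Re k\<bar> \<le> norm k / 2) \<and>
     (dispersion k = 0 \<longleftrightarrow> (\<exists>m::int. k = \<Psi> 1 (of_int m) k) \<or> (\<exists>m::int. k = \<Psi> (-1) (of_int m) k))" if "norm k \<ge> 2 / \<delta>" for k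
  proof -
    have "0 < 2 / \<delta>" using \<delta>(1) by simp
    then have "norm k > 0" using that by linarith
    moreover from this have "norm (1 / k) < \<delta>"
      using that \<delta>(1) mult_pos_pos[of \<delta> "norm k"] by (simp add: norm_divide field_simps)
    ultimately show ?thesis using \<delta>(2)[of "1 / k"] by simp
  qed
  show thesis
  proof (rule that[of "2 / \<delta>"])
    fix k assume k: "norm k \<ge> 2 / \<delta>" "Im k \<ge> 0" "dispersion k = 0"
    then have "\<bar>Re k\<bar> \<le> norm k / 2" using *[OF k(1)] by blast
    then show "Im k \<ge> norm k / 2" using k(2) cmod_le[of k] by linarith
  next
    show "2 / \<delta> > 0" using \<delta>(1) by simp
  qed (use * in blast)
qed

lemma enumeration:
  "\<exists>n\<^sub>0 k\<^sub>p k\<^sub>m. n\<^sub>0 \<ge> 1 \<and> enumerate_almost_all (upper_solutions k\<^sub>f dispersion) n\<^sub>0 k\<^sub>p k\<^sub>m \<and>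
     (\<lambda>n. k\<^sub>p n - branch_equation.target h 1 a (k\<^sub>l\<^sup>2 + k\<^sub>t\<^sup>2) n) \<in> o(\<lambda>n. 1 / of_nat n) \<and>
     (\<lambda>n. k\<^sub>m n - branch_equation.target h (- 1) a (k\<^sub>l\<^sup>2 + k\<^sub>t\<^sup>2) n) \<in> o(\<lambda>n. 1 / of_nat n)"
proof -
  interpret P: branch_equation h 1 a "k\<^sub>l\<^sup>2 + k\<^sub>t\<^sup>2" "e 1" by (rule branch_equation_e) simp
  interpret M: branch_equation h "- 1" a "k\<^sub>l\<^sup>2 + k\<^sub>t\<^sup>2" "e (- 1)" by (rule branch_equation_e) simp
  \<comment> \<open>The conjugate function with d replaced by -d: the locale assumptions do not
    constrain \<open>c\<close>, so all results hold for \<open>- c\<close> as well.\<close>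
  interpret C: plate_phase h k\<^sub>t k\<^sub>l k\<^sub>f "- c" \<sigma> a by (rule plate_phase_axioms)
  obtain R\<^sub>0 where R0: "R\<^sub>0 > 0"
    "\<And>k. norm k \<ge> R\<^sub>0 \<Longrightarrow> Im k \<ge> 0 \<Longrightarrow> dispersion k = 0 \<Longrightarrow> Im k \<ge> norm k / 2"
    "\<And>k. norm k \<ge> R\<^sub>0 \<Longrightarrow> dispersion k = 0 \<longleftrightarrow> (\<exists>m::int. k = \<Psi> 1 (of_int m) k) \<or> (\<exists>m::int. k = \<Psi> (-1) (of_int m) k)"
    by (rule large_solutions, rule that, assumption+)
  obtain R\<^sub>C where RC: "R\<^sub>C > 0"
    "\<And>k. norm k \<ge> R\<^sub>C \<Longrightarrow> Im k \<ge> 0 \<Longrightarrow> C.dispersion k = 0 \<Longrightarrow> Im k \<ge> norm k / 2"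
    by (rule C.large_solutions, rule that, assumption+)
  obtain R\<^sub>1 where R1: "R\<^sub>1 > 0"
    "\<And>R. R \<ge> R\<^sub>1 \<Longrightarrow> \<exists>N \<kappa>. (\<forall>n\<ge>N. Im (\<kappa> n) \<ge> R \<and> \<kappa> n = \<Psi> 1 (real n) (\<kappa> n)) \<and>
       (\<forall>n\<^sub>0\<ge>N. finite ({k. Im k \<ge> R \<and> (\<exists>m::int. k = \<Psi> 1 (of_int m) k)} - \<kappa> ` {n\<^sub>0..}))"
    by (rule P.fixed_points, rule that, assumption+)
  obtain R\<^sub>2 where R2: "R\<^sub>2 > 0"
    "\<And>R. R \<ge> R\<^sub>2 \<Longrightarrow> \<exists>N \<kappa>. (\<forall>n\<ge>N. Im (\<kappa> n) \<ge> R \<and> \<kappa> n = \<Psi> (- 1) (real n) (\<kappa> n)) \<and>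
       (\<forall>n\<^sub>0\<ge>N. finite ({k. Im k \<ge> R \<and> (\<exists>m::int. k = \<Psi> (- 1) (of_int m) k)} - \<kappa> ` {n\<^sub>0..}))"
    by (rule M.fixed_points, rule that, assumption+)
  obtain R\<^sub>3 where R3: "R\<^sub>3 > 0"
    "\<And>\<kappa>. \<forall>\<^sub>F n in sequentially. Im (\<kappa> n) \<ge> R\<^sub>3 \<and> \<kappa> n = \<Psi> 1 (real n) (\<kappa> n) \<Longrightarrow>
      (\<lambda>n. \<kappa> n - P.target n) \<in> o(\<lambda>n. 1 / of_nat n)"
    by (rule P.fixed_point_asymptotics, rule that, assumption+)
  obtain R\<^sub>4 where R4: "R\<^sub>4 > 0"
    "\<And>\<kappa>. \<forall>\<^sub>F n in sequentially. Im (\<kappa> n) \<ge> R\<^sub>4 \<and> \<kappa> n = \<Psi> (- 1) (real n) (\<kappa> n) \<Longrightarrow>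
      (\<lambda>n. \<kappa> n - M.target n) \<in> o(\<lambda>n. 1 / of_nat n)"
    by (rule M.fixed_point_asymptotics, rule that, assumption+)
  obtain R\<^sub>5 where R5: "R\<^sub>5 > 0" "\<And>k x. Im k \<ge> R\<^sub>5 \<Longrightarrow> k = \<Psi> 1 x k \<Longrightarrow> 1 * Re k > 0"
    by (rule P.fixed_point_sign, rule that, assumption+)
  obtain R\<^sub>6 where R6: "R\<^sub>6 > 0" "\<And>k x. Im k \<ge> R\<^sub>6 \<Longrightarrow> k = \<Psi> (- 1) x k \<Longrightarrow> - 1 * Re k > 0"
    by (rule M.fixed_point_sign, rule that, assumption+)

  define R where "R = R\<^sub>0 + R\<^sub>1 + R\<^sub>2 + R\<^sub>3 + R\<^sub>4 + R\<^sub>5 + R\<^sub>6"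
  have R: "R \<ge> R\<^sub>0" "R \<ge> R\<^sub>1" "R \<ge> R\<^sub>2" "R \<ge> R\<^sub>3" "R \<ge> R\<^sub>4" "R \<ge> R\<^sub>5" "R \<ge> R\<^sub>6" "R > 0"
    using R0(1) R1(1) R2(1) R3(1) R4(1) R5(1) R6(1) unfolding R_def by linarith+
  obtain N\<^sub>p \<kappa>\<^sub>p where p0: "\<forall>n\<ge>N\<^sub>p. Im (\<kappa>\<^sub>p n) \<ge> R \<and> \<kappa>\<^sub>p n = \<Psi> 1 (real n) (\<kappa>\<^sub>p n)"
      "\<forall>n\<^sub>0\<ge>N\<^sub>p. finite ({k. Im k \<ge> R \<and> (\<exists>m::int. k = \<Psi> 1 (of_int m) k)} - \<kappa>\<^sub>p ` {n\<^sub>0..})"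
    using R1(2)[OF R(2)] by (elim exE conjE) (rule that)
  have p: "Im (\<kappa>\<^sub>p n) \<ge> R" "\<kappa>\<^sub>p n = \<Psi> 1 (real n) (\<kappa>\<^sub>p n)" if "n \<ge> N\<^sub>p" for n
    using p0(1)[rule_format, OF that] by blast+
  obtain N\<^sub>m \<kappa>\<^sub>m where m0: "\<forall>n\<ge>N\<^sub>m. Im (\<kappa>\<^sub>m n) \<ge> R \<and> \<kappa>\<^sub>m n = \<Psi> (- 1) (real n) (\<kappa>\<^sub>m n)"
      "\<forall>n\<^sub>0\<ge>N\<^sub>m. finite ({k. Im k \<ge> R \<and> (\<exists>m::int. k = \<Psi> (- 1) (of_int m) k)} - \<kappa>\<^sub>m ` {n\<^sub>0..})"
    using R2(2)[OF R(3)] by (elim exE conjE) (rule that)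
  have m: "Im (\<kappa>\<^sub>m n) \<ge> R" "\<kappa>\<^sub>m n = \<Psi> (- 1) (real n) (\<kappa>\<^sub>m n)" if "n \<ge> N\<^sub>m" for n
    using m0(1)[rule_format, OF that] by blast+
  define n\<^sub>0 where "n\<^sub>0 = max 1 (max N\<^sub>p N\<^sub>m)"
  have n0: "n\<^sub>0 \<ge> 1" "n\<^sub>0 \<ge> N\<^sub>p" "n\<^sub>0 \<ge> N\<^sub>m" by (auto simp: n\<^sub>0_def)
  let ?S = "upper_solutions k\<^sub>f dispersion"

  have norm_ge: "norm k \<ge> R" if "Im k \<ge> R" for k
    using that abs_Im_le_cmod[of k] by linarith
  \<comment> \<open>A positive imaginary part keeps k away from the excluded real points.\<close>
  have in_S: "k \<in> ?S" if "Im k \<ge> R" "dispersion k = 0" for k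
    using that R(8) by (auto simp: upper_solutions_def)
  have pS: "\<kappa>\<^sub>p n \<in> ?S" if "n \<ge> n\<^sub>0" for n
  proof (rule in_S)
    have n: "n \<ge> N\<^sub>p" using that n0 by simp
    show "Im (\<kappa>\<^sub>p n) \<ge> R" by (rule p(1)[OF n])
    then have "norm (\<kappa>\<^sub>p n) \<ge> R\<^sub>0" using norm_ge[of "\<kappa>\<^sub>p n"] R(1) by linarith
    moreover have "\<kappa>\<^sub>p n = \<Psi> 1 (of_int (int n)) (\<kappa>\<^sub>p n)" using p(2)[OF n] by (simp only: of_int_of_nat_eq)
    ultimately show "dispersion (\<kappa>\<^sub>p n) = 0" using R0(3) by blast
  qed
  have mS: "\<kappa>\<^sub>m n \<in> ?S" if "n \<ge> n\<^sub>0" for n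
  proof (rule in_S)
    have n: "n \<ge> N\<^sub>m" using that n0 by simp
    show "Im (\<kappa>\<^sub>m n) \<ge> R" by (rule m(1)[OF n])
    then have "norm (\<kappa>\<^sub>m n) \<ge> R\<^sub>0" using norm_ge[of "\<kappa>\<^sub>m n"] R(1) by linarith
    moreover have "\<kappa>\<^sub>m n = \<Psi> (-1) (of_int (int n)) (\<kappa>\<^sub>m n)" using m(2)[OF n] by (simp only: of_int_of_nat_eq)
    ultimately show "dispersion (\<kappa>\<^sub>m n) = 0" using R0(3) by blast
  qed
  have p_inj: "inj_on \<kappa>\<^sub>p {n\<^sub>0..}"
  proof (rule inj_onI)
    fix i j assume ij: "i \<in> {n\<^sub>0..}" "j \<in> {n\<^sub>0..}" "\<kappa>\<^sub>p i = \<kappa>\<^sub>p j"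
    then have "i \<ge> N\<^sub>p" "j \<ge> N\<^sub>p" using n0(2) by simp_all
    then have "\<Psi> 1 (real i) (\<kappa>\<^sub>p j) = \<Psi> 1 (real j) (\<kappa>\<^sub>p j)"
      using trans[OF sym[OF p(2)[of i, unfolded ij(3)]] p(2)[of j]] by blast
    then have "real i = real j" by (rule P.fixed_point_inj)
    then show "i = j" by simp
  qed
  have m_inj: "inj_on \<kappa>\<^sub>m {n\<^sub>0..}"
  proof (rule inj_onI)
    fix i j assume ij: "i \<in> {n\<^sub>0..}" "j \<in> {n\<^sub>0..}" "\<kappa>\<^sub>m i = \<kappa>\<^sub>m j"
    then have "i \<ge> N\<^sub>m" "j \<ge> N\<^sub>m" using n0(3) by simp_all
    then have "\<Psi> (- 1) (real i) (\<kappa>\<^sub>m j) = \<Psi> (- 1) (real j) (\<kappa>\<^sub>m j)"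
      using trans[OF sym[OF m(2)[of i, unfolded ij(3)]] m(2)[of j]] by blast
    then have "real i = real j" by (rule M.fixed_point_inj)
    then show "i = j" by simp
  qed
  have disj: "\<kappa>\<^sub>p i \<noteq> \<kappa>\<^sub>m j" if "i \<ge> n\<^sub>0" "j \<ge> n\<^sub>0" for i j
  proof -
    have i: "i \<ge> N\<^sub>p" and j: "j \<ge> N\<^sub>m" using that n0 by auto
    have "1 * Re (\<kappa>\<^sub>p i) > 0" by (rule R5(2)[OF order.trans[OF R(6) p(1)[OF i]] p(2)[OF i]])
    moreover have "- 1 * Re (\<kappa>\<^sub>m j) > 0" by (rule R6(2)[OF order.trans[OF R(7) m(1)[OF j]] m(2)[OF j]])
    ultimately show ?thesis by auto
  qed
  have fin: "finite (?S - (\<kappa>\<^sub>p ` {n\<^sub>0..} \<union> \<kappa>\<^sub>m ` {n\<^sub>0..}))"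
  proof -
    \<comment> \<open>A real point so large that neither \<open>c\<close> nor \<open>- c\<close>
      admits a zero: a zero would have imaginary part at least x/2 > 0. Adding the modulus of
      \<open>k\<^sub>f\<close> avoids d = 0.\<close>
    define x where "x = R\<^sub>0 + R\<^sub>C + \<bar>k\<^sub>f\<bar>"
    have x: "x \<ge> R\<^sub>0" "x \<ge> R\<^sub>C" "x > \<bar>k\<^sub>f\<bar>" "x > 0" using R0(1) RC(1) unfolding x_def by linarith+
    \<comment> \<open>The radius is 2R because a solution with |k| > 2R and Im k >= 0 has Im k >=
      |k|/2 > R and is then covered by the fixed points.\<close>
    have "finite {k. norm k \<le> 2 * R \<and> k \<notin> {0, of_real k\<^sub>f, - of_real k\<^sub>f} \<and> dispersion k = 0}"
    proof (rule finite_bounded_solutions[OF sigma, of "of_real x"])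
      show "dispersion (of_real x) \<noteq> 0" "C.dispersion (of_real x) \<noteq> 0"
        using R0(2)[of "of_real x"] RC(2)[of "of_real x"] x by auto
      have "k\<^sub>f\<^sup>2 < x\<^sup>2" using x by (intro power2_strict_mono) auto
      then have "complex_of_real (x\<^sup>2) \<noteq> of_real (k\<^sub>f\<^sup>2)" by (subst of_real_eq_iff) auto
      then show "(complex_of_real x)\<^sup>2 \<noteq> (of_real k\<^sub>f)\<^sup>2" by simp
    qed (use x in auto)
    moreover note p0(2)[rule_format, OF n0(2)] m0(2)[rule_format, OF n0(3)]
    ultimately have "finite ({k. norm k \<le> 2 * R \<and> k \<notin> {0, of_real k\<^sub>f, - of_real k\<^sub>f} \<and> dispersion k = 0}
       \<union> ({k. Im k \<ge> R \<and> (\<exists>m::int. k = \<Psi> 1 (of_int m) k)} - \<kappa>\<^sub>p ` {n\<^sub>0..})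
       \<union> ({k. Im k \<ge> R \<and> (\<exists>m::int. k = \<Psi> (- 1) (of_int m) k)} - \<kappa>\<^sub>m ` {n\<^sub>0..}))" by (intro finite_UnI)
    moreover have "?S - (\<kappa>\<^sub>p ` {n\<^sub>0..} \<union> \<kappa>\<^sub>m ` {n\<^sub>0..}) \<subseteq>
       {k. norm k \<le> 2 * R \<and> k \<notin> {0, of_real k\<^sub>f, - of_real k\<^sub>f} \<and> dispersion k = 0}
       \<union> ({k. Im k \<ge> R \<and> (\<exists>m::int. k = \<Psi> 1 (of_int m) k)} - \<kappa>\<^sub>p ` {n\<^sub>0..})
       \<union> ({k. Im k \<ge> R \<and> (\<exists>m::int. k = \<Psi> (- 1) (of_int m) k)} - \<kappa>\<^sub>m ` {n\<^sub>0..})"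
      (is "_ \<subseteq> ?U")
    proof
      fix k assume k: "k \<in> ?S - (\<kappa>\<^sub>p ` {n\<^sub>0..} \<union> \<kappa>\<^sub>m ` {n\<^sub>0..})"
      then have S: "k \<notin> {0, of_real k\<^sub>f, - of_real k\<^sub>f}" "dispersion k = 0" "Im k \<ge> 0"
        unfolding upper_solutions_def by blast+
      show "k \<in> ?U"
      proof (cases "norm k \<le> 2 * R")
        case True
        then show ?thesis using S by blast
      next
        case False
        then have norm: "norm k \<ge> R\<^sub>0" using R(1,8) by linarith
        have "Im k \<ge> R" using R0(2)[OF norm S(3,2)] False by linarith
        then show ?thesis using R0(3)[OF norm] S(2) k by blast
      qed
    qed
    ultimately show ?thesis by (rule rev_finite_subset)
  qed
  have "\<kappa>\<^sub>p ` {n\<^sub>0..} \<subseteq> ?S" "\<kappa>\<^sub>m ` {n\<^sub>0..} \<subseteq> ?S" "\<kappa>\<^sub>p ` {n\<^sub>0..} \<inter> \<kappa>\<^sub>m ` {n\<^sub>0..} = {}"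
    using pS mS disj by auto
  with p_inj m_inj fin have "enumerate_almost_all ?S n\<^sub>0 \<kappa>\<^sub>p \<kappa>\<^sub>m"
    unfolding enumerate_almost_all_def by (intro conjI)
  moreover have "(\<lambda>n. \<kappa>\<^sub>p n - P.target n) \<in> o(\<lambda>n. 1 / of_nat n)"
    by (rule R3(2), rule eventually_mono[OF eventually_ge_at_top[of N\<^sub>p]], rule conjI[OF order.trans[OF R(4) p(1)] p(2)])
  moreover have "(\<lambda>n. \<kappa>\<^sub>m n - M.target n) \<in> o(\<lambda>n. 1 / of_nat n)"
    by (rule R4(2), rule eventually_mono[OF eventually_ge_at_top[of N\<^sub>m]], rule conjI[OF order.trans[OF R(5) m(1)] m(2)])
  ultimately show ?thesis using n0(1) by (intro exI[of _ n\<^sub>0] exI[of _ \<kappa>\<^sub>p] exI[of _ \<kappa>\<^sub>m] conjI)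
qed

end

section \<open>Specialisation to the symmetric and antisymmetric cases\<close>

lemma target_eq:
  assumes "branch_equation h \<tau> S e"
  shows "branch_equation.target h \<tau> (pi * x) S n =
      of_real \<tau> * of_real (ln (4 * pi * real n) / (2 * h) - x / (4 * h * real n))
      + \<i> / of_real (2 * h) * of_real (pi * (2 * real n - x) - ln (4 * pi * real n) / (2 * pi * real n)
          - h\<^sup>2 * S / (2 * pi * real n))"
proof -
  have "pi * x / (4 * pi * h * real n) = x / (4 * h * real n)" by simp
  moreover have "2 * pi * real n - pi * x = pi * (2 * real n - x)" by (simp add: algebra_simps)
  ultimately show ?thesis unfolding branch_equation.target_def[OF assms] by (simp only:)
qed

text \<open>With phase a = pi x, the real correction a/(4 pi h n) becomes y/(hn) for y = x/4. The
  values x = 1/2 and x = 3/2, forced by exp(i pi x) = i \<sigma>, explain the constants 1/8 and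
  3/8.\<close>

lemma plate_dispersion_enumeration:
  assumes "h > 0" "k\<^sub>l > 0" "k\<^sub>l < k\<^sub>t" "\<sigma> = 1 \<or> \<sigma> = - 1" "exp (\<i> * of_real (pi * x)) = \<i> * of_real \<sigma>" "y = x / 4"
  shows "\<exists>n\<^sub>0 k\<^sub>p k\<^sub>m. n\<^sub>0 \<ge> 1 \<and>
      enumerate_almost_all (upper_solutions k\<^sub>f (plate_dispersion h k\<^sub>t k\<^sub>l k\<^sub>f c \<sigma>)) n\<^sub>0 k\<^sub>p k\<^sub>m \<and>
      (\<lambda>n. k\<^sub>p n - (of_real (ln (4 * pi * real n) / (2 * h)) - of_real (y / (h * real n))
           + \<i> / of_real (2 * h) * of_real (pi * (2 * real n - x) - ln (4 * pi * real n) / (2 * pi * real n)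
               - h\<^sup>2 * (k\<^sub>l\<^sup>2 + k\<^sub>t\<^sup>2) / (2 * pi * real n)))) \<in> o(\<lambda>n. 1 / of_nat n) \<and>
      (\<lambda>n. k\<^sub>m n - (- of_real (ln (4 * pi * real n) / (2 * h)) + of_real (y / (h * real n))
           + \<i> / of_real (2 * h) * of_real (pi * (2 * real n - x) - ln (4 * pi * real n) / (2 * pi * real n)
               - h\<^sup>2 * (k\<^sub>l\<^sup>2 + k\<^sub>t\<^sup>2) / (2 * pi * real n)))) \<in> o(\<lambda>n. 1 / of_nat n)"
proof -
  interpret plate_phase h k\<^sub>t k\<^sub>l k\<^sub>f c \<sigma> "pi * x"
    by unfold_locales (use assms in auto)
  have y: "x / (4 * h * real n) = y / (h * real n)" for n unfolding assms(6) by simp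
  have 1: "of_real 1 * of_real (u - v) = complex_of_real u - of_real v"
    "of_real (- 1) * of_real (u - v) = - complex_of_real u + of_real v" for u v by simp_all
  show ?thesis
    using enumeration
    unfolding target_eq[OF branch_equation_e[OF disjI1[OF refl]]] target_eq[OF branch_equation_e[OF disjI2[OF refl]]] y 1 .
qed

theorem theorem4:
  fixes h k\<^sub>t k\<^sub>l k\<^sub>f \<rho> \<rho>\<^sub>f :: real
  assumes "h > 0" and "k\<^sub>t > k\<^sub>l" and "k\<^sub>l > 0" and "k\<^sub>f > 0" and "\<rho> > 0" and "\<rho>\<^sub>f > 0"
  shows "(\<exists>n\<^sub>0 k\<^sub>p k\<^sub>m. n\<^sub>0 \<ge> 1 \<and>
          enumerate_almost_all
            (upper_solutions k\<^sub>f (symmetric_dispersion h k\<^sub>t k\<^sub>l k\<^sub>f \<rho> \<rho>\<^sub>f)) n\<^sub>0 k\<^sub>p k\<^sub>m \<and>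
          (\<lambda>n. k\<^sub>p n -
              (of_real (ln (4 * pi * real n) / (2 * h)) - of_real (1 / (8 * h * real n))
               + \<i> / of_real (2 * h) * of_real (pi * (2 * real n - 1 / 2)
                   - ln (4 * pi * real n) / (2 * pi * real n)
                   - h\<^sup>2 * (k\<^sub>l\<^sup>2 + k\<^sub>t\<^sup>2) / (2 * pi * real n))))
            \<in> o(\<lambda>n. 1 / of_nat n) \<and>
          (\<lambda>n. k\<^sub>m n -
              (- of_real (ln (4 * pi * real n) / (2 * h)) + of_real (1 / (8 * h * real n))
               + \<i> / of_real (2 * h) * of_real (pi * (2 * real n - 1 / 2)
                   - ln (4 * pi * real n) / (2 * pi * real n)
                   - h\<^sup>2 * (k\<^sub>l\<^sup>2 + k\<^sub>t\<^sup>2) / (2 * pi * real n))))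
            \<in> o(\<lambda>n. 1 / of_nat n)) \<and>
         (\<exists>n\<^sub>0 k\<^sub>p k\<^sub>m. n\<^sub>0 \<ge> 1 \<and>
          enumerate_almost_all
            (upper_solutions k\<^sub>f (antisymmetric_dispersion h k\<^sub>t k\<^sub>l k\<^sub>f \<rho> \<rho>\<^sub>f)) n\<^sub>0 k\<^sub>p k\<^sub>m \<and>
          (\<lambda>n. k\<^sub>p n -
              (of_real (ln (4 * pi * real n) / (2 * h)) - of_real (3 / (8 * h * real n))
               + \<i> / of_real (2 * h) * of_real (pi * (2 * real n - 3 / 2)
                   - ln (4 * pi * real n) / (2 * pi * real n)
                   - h\<^sup>2 * (k\<^sub>l\<^sup>2 + k\<^sub>t\<^sup>2) / (2 * pi * real n))))
            \<in> o(\<lambda>n. 1 / of_nat n) \<and>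
          (\<lambda>n. k\<^sub>m n -
              (- of_real (ln (4 * pi * real n) / (2 * h)) + of_real (3 / (8 * h * real n))
               + \<i> / of_real (2 * h) * of_real (pi * (2 * real n - 3 / 2)
                   - ln (4 * pi * real n) / (2 * pi * real n)
                   - h\<^sup>2 * (k\<^sub>l\<^sup>2 + k\<^sub>t\<^sup>2) / (2 * pi * real n))))
            \<in> o(\<lambda>n. 1 / of_nat n))"
proof -
  have phase: "exp (\<i> * of_real (pi * (1 / 2))) = \<i> * of_real 1" "exp (\<i> * of_real (pi * (3 / 2))) = \<i> * of_real (- 1)"
  proof -
    have "cis (pi * (3 / 2)) = cis pi * cis (pi / 2)" unfolding cis_mult by (simp add: field_simps)
    then show "exp (\<i> * of_real (pi * (1 / 2))) = \<i> * of_real 1" "exp (\<i> * of_real (pi * (3 / 2))) = \<i> * of_real (- 1)"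
      unfolding cis_conv_exp[symmetric] by simp_all
  qed
  have y: "v / (8 * h * real n) = v / 8 / (h * real n)" for v n by simp
  show ?thesis
    unfolding symmetric_eq_plate_dispersion antisymmetric_eq_plate_dispersion y
    by (intro conjI plate_dispersion_enumeration phase) (use assms in auto)
qed

end
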